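(* The tetrablock $\mathbb{E}$ is not an analytic retract of the open unit ball of any $J^*$-algebra of finite rank. That is, if $\mathcal{A}$ is a $J^*$-algebra of finite rank with open unit ball $B$, then there do not exist analytic maps $h:\mathbb{E}\to B$ and $\kappa:B\to\mathbb{E}$ such that $\kappa\circ h=\mathrm{id}_{\mathbb{E}}$.
   Context: The tetrablock is the domain $$\mathbb{E}=\{(x_1,x_2,x_3)\in\mathbb{C}^3: 1-x_1z-x_2w+x_3zw\neq 0 \text{ for all } z,w\in\mathbb{C} \text{ with } |z|\leq 1,\ |w|\leq 1\}.$$ For (complex) Hilbert spaces $H,K$, $\mathcal{L}(H,K)$ is the Banach space of bounded linear operators from $H$ to $K$ with the operator norm. A $J^*$-algebra is a closed (complex linear) subspace $\mathcal{A}$ of $\mathcal{L}(H,K)$, for some Hilbert spaces $H,K$, such that $T\in\mathcal{A}$ implies $TT^*T\in\mathcal{A}$; its open unit ball is $\{T\in\mathcal{A}:\|T\|<1\}$. The rank of $\mathcal{A}$ is the supremum over all $T\in\mathcal{A}$ of the number of non-zero elements in the spectrum of $T^*T$. A domain $\Omega_1$ is an analytic retract of a domain $\Omega_2$ if there exist analytic (holomorphic) maps $h:\Omega_1\to\Omega_2$ and $\kappa:\Omega_2\to\Omega_1$ such that $\kappa\circ h=\mathrm{id}_{\Omega_1}$. *)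

theory Defs
  imports "HOL-Analysis.Analysis" "HOL-Library.Extended_Nat"
begin

section \<open>Complex normed spaces and complex Hilbert spaces\<close>

class complex_normed_vector = real_normed_vector +
  fixes scaleC :: "complex \<Rightarrow> 'a \<Rightarrow> 'a" (infixr \<open>*\<^sub>C\<close> 75)
  assumes scaleC_add_right: "c *\<^sub>C (x + y) = c *\<^sub>C x + c *\<^sub>C y"
    and scaleC_add_left: "(c + d) *\<^sub>C x = c *\<^sub>C x + d *\<^sub>C x"
    and scaleC_scaleC: "c *\<^sub>C d *\<^sub>C x = (c * d) *\<^sub>C x"
    and scaleR_scaleC: "r *\<^sub>R x = complex_of_real r *\<^sub>C x"
    and norm_scaleC: "norm (c *\<^sub>C x) = cmod c * norm x"

interpretation complex_vector:
  vector_space "scaleC :: complex \<Rightarrow> 'a \<Rightarrow> 'a::complex_normed_vector"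
proof
  show "1 *\<^sub>C x = x" for x :: 'a
    using scaleR_scaleC[of 1 x] by simp
qed (simp_all add: scaleC_add_right scaleC_add_left scaleC_scaleC)

text \<open>The inner product is linear in the first argument; positive definiteness follows
  from \<open>cinner_self\<close>.\<close>

class complex_hilbert = complex_normed_vector + complete_space +
  fixes cinner :: "'a \<Rightarrow> 'a \<Rightarrow> complex"
  assumes cinner_commute: "cinner x y = cnj (cinner y x)"
    and cinner_add_left: "cinner (x + y) z = cinner x z + cinner y z"
    and cinner_scaleC_left: "cinner (c *\<^sub>C x) y = c * cinner x y"
    and cinner_self: "cinner x x = complex_of_real ((norm x)\<^sup>2)"

instantiation complex :: complex_hilbert
begin

definition scaleC_complex :: "complex \<Rightarrow> complex \<Rightarrow> complex"
  where "scaleC_complex c x = c * x"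

definition cinner_complex :: "complex \<Rightarrow> complex \<Rightarrow> complex"
  where "cinner_complex x y = x * cnj y"

instance
proof
  show "cinner x x = complex_of_real ((norm x)\<^sup>2)" for x :: complex
    unfolding cinner_complex_def by (rule complex_norm_square[symmetric])
qed (simp_all add: scaleC_complex_def cinner_complex_def norm_mult algebra_simps scaleR_conv_of_real)

end

instantiation vec :: (complex_normed_vector, finite) complex_normed_vector
begin

definition scaleC_vec :: "complex \<Rightarrow> 'a ^ 'b \<Rightarrow> 'a ^ 'b"
  where "scaleC_vec c x = (\<chi> i. c *\<^sub>C x $ i)"

instance
proof
  show "norm (c *\<^sub>C x) = cmod c * norm x" for c and x :: "'a ^ 'b"
    by (simp add: scaleC_vec_def norm_vec_def norm_scaleC L2_set_right_distrib)
qed (simp_all add: scaleC_vec_def vec_eq_iff scaleC_add_right scaleC_add_left scaleC_scaleC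
      scaleR_scaleC)

end


section \<open>Bounded complex linear operators\<close>

lemma bounded_linear_scaleC:
  "bounded_linear (\<lambda>x::'a::complex_normed_vector. c *\<^sub>C x)"
  by (rule bounded_linear_intro[where K = "cmod c"])
    (simp_all add: scaleC_add_right scaleR_scaleC norm_scaleC mult.commute)

text \<open>The type \<open>'a \<Rightarrow>\<^sub>L 'b\<close> consists of the bounded \<^emph>\<open>real\<close> linear maps. Scaling the values makes it a
  complex normed space, of which the complex linear maps form a closed subspace.\<close>

instantiation blinfun :: (real_normed_vector, complex_normed_vector) complex_normed_vector
begin

lift_definition scaleC_blinfun :: "complex \<Rightarrow> 'a \<Rightarrow>\<^sub>L 'b \<Rightarrow> 'a \<Rightarrow>\<^sub>L 'b"
  is "\<lambda>c f x. c *\<^sub>C f x"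
  by (rule bounded_linear_compose[OF bounded_linear_scaleC])

instance
proof
  fix c d :: complex and r :: real and f g :: "'a \<Rightarrow>\<^sub>L 'b"
  show "c *\<^sub>C (f + g) = c *\<^sub>C f + c *\<^sub>C g"
    by (rule blinfun_eqI) (simp add: scaleC_blinfun.rep_eq blinfun.add_left scaleC_add_right)
  show "(c + d) *\<^sub>C f = c *\<^sub>C f + d *\<^sub>C f"
    by (rule blinfun_eqI) (simp add: scaleC_blinfun.rep_eq blinfun.add_left scaleC_add_left)
  show "c *\<^sub>C d *\<^sub>C f = (c * d) *\<^sub>C f"
    by (rule blinfun_eqI) (simp add: scaleC_blinfun.rep_eq scaleC_scaleC)
  show "r *\<^sub>R f = complex_of_real r *\<^sub>C f"
    by (rule blinfun_eqI) (simp add: scaleC_blinfun.rep_eq blinfun.scaleR_left scaleR_scaleC)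
  have le: "norm (e *\<^sub>C h) \<le> cmod e * norm h" for e and h :: "'a \<Rightarrow>\<^sub>L 'b"
    by (rule norm_blinfun_bound)
      (simp_all add: scaleC_blinfun.rep_eq norm_scaleC mult.assoc mult_left_mono norm_blinfun)
  show "norm (c *\<^sub>C f) = cmod c * norm f"
  proof (cases "c = 0")
    case True
    then show ?thesis using le[of 0 f] by simp
  next
    case False
    have "f = inverse c *\<^sub>C c *\<^sub>C f"
      by (rule blinfun_eqI) (simp add: False scaleC_blinfun.rep_eq scaleC_scaleC)
    then have "norm f \<le> cmod (inverse c) * norm (c *\<^sub>C f)"
      using le[of "inverse c" "c *\<^sub>C f"] by simp
    then have "cmod c * norm f \<le> cmod c * (cmod (inverse c) * norm (c *\<^sub>C f))"
      by (rule mult_left_mono) simp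
    with False have "cmod c * norm f \<le> norm (c *\<^sub>C f)"
      by (simp add: norm_inverse flip: mult.assoc)
    with le[of c f] show ?thesis by simp
  qed
qed

end

definition bounded_clinear_ops ::
    "('a::complex_normed_vector \<Rightarrow>\<^sub>L 'b::complex_normed_vector) set"
  where "bounded_clinear_ops = {T. Vector_Spaces.linear scaleC scaleC (blinfun_apply T)}"

text \<open>Existence and uniqueness of the adjoint are the Riesz representation theorem; the adjoint of
  a complex linear operator is complex linear.\<close>

definition cadjoint ::
    "('a::complex_hilbert \<Rightarrow>\<^sub>L 'b::complex_hilbert) \<Rightarrow> ('b \<Rightarrow>\<^sub>L 'a)"
  where "cadjoint T = (THE S. \<forall>x y. cinner (blinfun_apply T x) y = cinner x (blinfun_apply S y))"

definition op_spectrum :: "('a::complex_hilbert \<Rightarrow>\<^sub>L 'a) \<Rightarrow> complex set"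
  where "op_spectrum T = {c. \<not> (\<exists>S \<in> bounded_clinear_ops.
    S o\<^sub>L (T - c *\<^sub>C id_blinfun) = id_blinfun \<and> (T - c *\<^sub>C id_blinfun) o\<^sub>L S = id_blinfun)}"


section \<open>\<open>J\<^sup>*\<close>-algebras\<close>

definition J_star_algebra :: "('a::complex_hilbert \<Rightarrow>\<^sub>L 'b::complex_hilbert) set \<Rightarrow> bool"
  where "J_star_algebra A \<longleftrightarrow>
    A \<subseteq> bounded_clinear_ops \<and> closed A \<and> complex_vector.subspace A \<and>
    (\<forall>T \<in> A. T o\<^sub>L cadjoint T o\<^sub>L T \<in> A)"

definition open_unit_ball :: "('a::real_normed_vector) set \<Rightarrow> 'a set"
  where "open_unit_ball A = {T \<in> A. norm T < 1}"

definition ecard :: "'a set \<Rightarrow> enat"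
  where "ecard S = (if finite S then enat (card S) else \<infinity>)"

definition J_star_rank :: "('a::complex_hilbert \<Rightarrow>\<^sub>L 'b::complex_hilbert) set \<Rightarrow> enat"
  where "J_star_rank A = (SUP T\<in>A. ecard (op_spectrum (cadjoint T o\<^sub>L T) - {0}))"


section \<open>Analytic maps and retracts\<close>

text \<open>Analyticity is complex Frechet differentiability at every point. Here \<open>V\<close> is the complex
  normed space in which \<open>U\<close> is a (relatively open) domain; it is a subspace of the type \<open>'a\<close>, and
  the derivative \<open>D\<close> is only constrained on \<open>V\<close>, so that nothing has to be extended from \<open>V\<close>
  to \<open>'a\<close>.\<close>

definition analytic_map ::
    "'a::complex_normed_vector set \<Rightarrow> 'a set \<Rightarrow> ('a \<Rightarrow> 'b::complex_normed_vector) \<Rightarrow> bool"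
  where "analytic_map V U f \<longleftrightarrow> (\<forall>x\<in>U. \<exists>D.
    (\<forall>u\<in>V. \<forall>v\<in>V. D (u + v) = D u + D v) \<and>
    (\<forall>c. \<forall>u\<in>V. D (c *\<^sub>C u) = c *\<^sub>C D u) \<and>
    (\<exists>K. \<forall>u\<in>V. norm (D u) \<le> K * norm u) \<and>
    ((\<lambda>y. norm (f y - f x - D (y - x)) / norm (y - x)) \<longlongrightarrow> 0) (at x within U))"

text \<open>\<open>\<Omega>\<^sub>1\<close> is a domain in the space \<open>V\<^sub>1\<close>, and \<open>\<Omega>\<^sub>2\<close> is a domain in the space \<open>V\<^sub>2\<close>.\<close>

definition analytic_retract ::
    "'a::complex_normed_vector set \<Rightarrow> 'a set \<Rightarrow> 'b::complex_normed_vector set \<Rightarrow> 'b set \<Rightarrow> bool"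
  where "analytic_retract V\<^sub>1 \<Omega>\<^sub>1 V\<^sub>2 \<Omega>\<^sub>2 \<longleftrightarrow> (\<exists>h \<kappa>.
    analytic_map V\<^sub>1 \<Omega>\<^sub>1 h \<and> h ` \<Omega>\<^sub>1 \<subseteq> \<Omega>\<^sub>2 \<and>
    analytic_map V\<^sub>2 \<Omega>\<^sub>2 \<kappa> \<and> \<kappa> ` \<Omega>\<^sub>2 \<subseteq> \<Omega>\<^sub>1 \<and>
    (\<forall>x\<in>\<Omega>\<^sub>1. \<kappa> (h x) = x))"

definition tetrablock :: "(complex ^ 3) set"
  where "tetrablock = {x. \<forall>z w. cmod z \<le> 1 \<and> cmod w \<le> 1 \<longrightarrow>
    1 - x $ 1 * z - x $ 2 * w + x $ 3 * z * w \<noteq> 0}"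

end

theory Submission
  imports Defs "HOL-Complex_Analysis.Conformal_Mappings" "HOL-Computational_Algebra.Formal_Power_Series"
begin

text \<open>
  Infinitesimally the tetrablock contains a complex \<open>\<ell>\<^sub>1\<close> plane: at the origin, the Caratheodory and
  Kobayashi metrics of the tetrablock give the tangent vector \<open>(a, 0, b)\<close> the length
  \<open>\<bar>a\<bar> + \<bar>b\<bar>\<close>. On the other hand the infinitesimal metric at \<open>0\<close> of the unit ball of a Banach space
  is its norm. An analytic retraction with \<open>h 0 = 0\<close> therefore gives, through the derivative of \<open>h\<close>,
  two operators \<open>T\<close> and \<open>S\<close> in the \<open>J\<^sup>*\<close>-algebra with \<open>norm T \<le> 1\<close>, \<open>norm S \<le> 1\<close> and
  \<open>norm (T + \<omega> S) \<ge> 2\<close> for every unimodular \<open>\<omega>\<close>.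

  Such a pair cannot exist in finite rank. If the unit vectors \<open>u\<close> almost attain the norm of
  \<open>T + \<omega> S\<close>, then \<open>T u \<approx> \<omega> S u\<close>, \<open>T\<^sup>* T u \<approx> u\<close> and \<open>S\<^sup>* S u \<approx> u\<close>, and hence
  \<open>R = T + T S\<^sup>* T\<close> satisfies \<open>R\<^sup>* R u \<approx> \<bar>1 + \<omega>\<bar>\<^sup>2 u\<close>. The operator \<open>R\<close> does not depend on \<open>\<omega>\<close> and
  belongs to the algebra by polarization of \<open>T T\<^sup>* T\<close>; the spectrum of \<open>R\<^sup>* R\<close> contains the interval
  from \<open>0\<close> to \<open>4\<close> (\<open>spectrum_of_ell1_pair\<close>, \<open>infinite_rank_if_ell1_pair\<close>).

  The metrics enter only through the Schwarz lemma. The bounds on \<open>T\<close> and \<open>S\<close> come from the discs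
  \<open>c \<mapsto> h (c, 0, 0)\<close> and \<open>c \<mapsto> h (0, 0, c)\<close> (\<open>Schwarz_operator_disc\<close>). The lower bound comes from
  the discs \<open>c \<mapsto> \<kappa> (c U)\<close> with \<open>U\<close> proportional to \<open>T + \<omega> S\<close>, composed with the functions
  \<open>(x\<^sub>1 - z x\<^sub>3) / (1 - z x\<^sub>2)\<close>, which map the tetrablock into the unit disc
  (\<open>Schwarz_tetrablock\<close>).

  The normalization \<open>h 0 = 0\<close> rests on the homogeneity of the ball
  (\<open>normalized_retraction\<close>): the operator Moebius transformation
  \<open>Z \<mapsto> B + (1 - B B\<^sup>*)\<^bsup>1/2\<^esup> Z (1 + B\<^sup>* Z)\<^bsup>-1\<^esup> (1 - B\<^sup>* B)\<^bsup>1/2\<^esup>\<close> takes \<open>0\<close> to \<open>B\<close>, maps the open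
  unit ball of the algebra to itself, is analytic, and has the transformation for \<open>-B\<close> as inverse
  (\<open>moebius_mem\<close>, \<open>norm_moebius_less_1\<close>, \<open>moebius_analytic\<close>, \<open>moebius_inverse\<close>). The square roots are
  binomial series, and adjoints exist by the Riesz representation theorem.
\<close>

section \<open>Complex scalar multiplication\<close>

lemma bounded_bilinear_scaleC:
  "bounded_bilinear (scaleC :: complex \<Rightarrow> 'a \<Rightarrow> 'a::complex_normed_vector)"
proof
  fix r :: real and a :: complex and b :: 'a
  show "(r *\<^sub>R a) *\<^sub>C b = r *\<^sub>R a *\<^sub>C b"
    by (simp add: scaleR_scaleC scaleC_scaleC scaleC_complex_def)
  show "a *\<^sub>C r *\<^sub>R b = r *\<^sub>R a *\<^sub>C b"
    by (simp add: scaleR_scaleC scaleC_scaleC mult.commute)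
  show "\<exists>K. \<forall>(a::complex) (b::'a). norm (a *\<^sub>C b) \<le> norm a * norm b * K"
    by (rule exI[of _ 1]) (simp add: norm_scaleC)
qed (simp_all add: scaleC_add_left scaleC_add_right)

interpretation scaleC: bounded_bilinear scaleC
  by (rule bounded_bilinear_scaleC)

lemma scaleC_minus_one: "(-1) *\<^sub>C x = - (x::'a::complex_normed_vector)"
  by simp

lemma scaleC_complex_eq_mult [simp]: "c *\<^sub>C (x::complex) = c * x"
  by (simp add: scaleC_complex_def)

section \<open>Complex Hilbert spaces and adjoints\<close>

subclass (in complex_hilbert) banach ..

lemma cinner_add_right: "cinner x (y + z) = cinner x y + cinner x (z::'a::complex_hilbert)"
  using cinner_commute[of x "y + z"] cinner_commute[of x y] cinner_commute[of x z]
  by (simp add: cinner_add_left)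

lemma cinner_scaleC_right: "cinner x (c *\<^sub>C y) = cnj c * cinner x (y::'a::complex_hilbert)"
  using cinner_commute[of x "c *\<^sub>C y"] cinner_commute[of x y] by (simp add: cinner_scaleC_left)

lemma norm_add_square:
  "(norm (x + y))\<^sup>2 = (norm x)\<^sup>2 + 2 * Re (cinner x y) + (norm (y::'a::complex_hilbert))\<^sup>2"
proof -
  have "complex_of_real ((norm (x + y))\<^sup>2)
      = of_real ((norm x)\<^sup>2) + (cinner x y + cnj (cinner x y)) + of_real ((norm y)\<^sup>2)"
    unfolding cinner_self[symmetric] by (simp add: cinner_add_left cinner_add_right flip: cinner_commute)
  also have "\<dots> = complex_of_real ((norm x)\<^sup>2 + 2 * Re (cinner x y) + (norm y)\<^sup>2)"
    by (simp add: complex_add_cnj)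
  finally show ?thesis by (simp only: of_real_eq_iff)
qed

lemma norm_diff_square:
  "(norm (x - y))\<^sup>2 = (norm x)\<^sup>2 - 2 * Re (cinner x y) + (norm (y::'a::complex_hilbert))\<^sup>2"
  using norm_add_square[of x "- y"] cinner_scaleC_right[of x "-1" y] by (simp add: scaleC_minus_one)

lemma parallelogram:
  "(norm (x - y))\<^sup>2 = 2 * (norm x)\<^sup>2 + 2 * (norm y)\<^sup>2 - (norm (x + y :: 'a::complex_hilbert))\<^sup>2"
  by (simp add: norm_diff_square norm_add_square)

text \<open>The vector subtracted is the component of \<open>x\<close> along \<open>y\<close>; the identity yields both the
  Cauchy--Schwarz inequality and the orthogonality of vectors of minimal norm.\<close>

lemma norm_orthogonal_component:
  fixes x y :: "'a::complex_hilbert"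
  assumes "y \<noteq> 0"
  shows "(norm (x - (cinner x y / of_real ((norm y)\<^sup>2)) *\<^sub>C y))\<^sup>2 = (norm x)\<^sup>2 - (cmod (cinner x y))\<^sup>2 / (norm y)\<^sup>2"
proof -
  let ?c = "cinner x y / of_real ((norm y)\<^sup>2)"
  have "cinner x (?c *\<^sub>C y) = of_real ((cmod (cinner x y))\<^sup>2 / (norm y)\<^sup>2)"
    by (simp add: cinner_scaleC_right complex_norm_square mult.commute del: of_real_power)
  moreover have "(norm (?c *\<^sub>C y))\<^sup>2 = (cmod (cinner x y))\<^sup>2 / (norm y)\<^sup>2"
    using assms by (simp add: norm_scaleC norm_divide norm_power power_mult_distrib power_divide)
      (simp add: field_simps power2_eq_square power4_eq_xxxx)
  ultimately show ?thesis by (simp add: norm_diff_square del: of_real_divide)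
qed

lemma cinner_Cauchy_Schwarz: "cmod (cinner x y) \<le> norm x * norm (y::'a::complex_hilbert)"
proof (cases "y = 0")
  case False
  have "0 \<le> (norm x)\<^sup>2 - (cmod (cinner x y))\<^sup>2 / (norm y)\<^sup>2"
    using norm_orthogonal_component[OF False, of x] by (metis zero_le_power2)
  with False have "(cmod (cinner x y))\<^sup>2 \<le> (norm x * norm y)\<^sup>2"
    by (simp add: field_simps power_mult_distrib)
  then show ?thesis by (rule power2_le_imp_le) simp
qed (use cinner_scaleC_right[of x 0 0] in simp)

lemma bounded_bilinear_cinner: "bounded_bilinear (cinner :: 'a::complex_hilbert \<Rightarrow> 'a \<Rightarrow> complex)"
proof
  show "\<exists>K. \<forall>x y :: 'a. norm (cinner x y) \<le> norm x * norm y * K"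
    by (rule exI[of _ 1]) (simp add: cinner_Cauchy_Schwarz)
qed (simp_all add: cinner_add_left cinner_add_right cinner_scaleC_left cinner_scaleC_right scaleR_scaleC
    scaleC_complex_def)

interpretation cinner: bounded_bilinear cinner
  by (rule bounded_bilinear_cinner)

declare cinner.zero_left [simp] cinner.zero_right [simp]

interpretation blinfun_compose: bounded_bilinear "(o\<^sub>L)"
  by (rule bounded_bilinear_blinfun_compose)

lemma cinner_left_eqI:
  assumes "\<And>x. cinner x y = cinner x (z::'a::complex_hilbert)"
  shows "y = z"
proof -
  have "cinner (y - z) (y - z) = 0"
    using assms[of "y - z"] by (simp only: cinner.diff_right) simp
  then show ?thesis by (simp add: cinner_self)
qed

text \<open>The representing vector is a multiple of the vector of least norm on the hyperplane where the
  functional takes the value \<open>1\<close>: by the parallelogram law a minimizing sequence converges, and by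
  minimality its limit is orthogonal to the kernel.\<close>

lemma Riesz_representation:
  fixes f :: "'a::complex_hilbert \<Rightarrow> complex"
  assumes f: "bounded_linear f" and hom: "\<And>c x. f (c *\<^sub>C x) = c * f x"
  shows "\<exists>z. \<forall>x. f x = cinner x z"
proof (cases "\<forall>x. f x = 0")
  case True
  then show ?thesis by (intro exI[of _ 0]) simp
next
  case False
  then obtain a where a: "f a \<noteq> 0" by blast
  interpret f: bounded_linear f by (rule f)
  define M where "M = {x. f x = 1}"
  have aM: "(1 / f a) *\<^sub>C a \<in> M" using a by (simp add: M_def hom)
  define d where "d = Inf (norm ` M)"
  have d_le: "d \<le> norm x" if "x \<in> M" for x
    unfolding d_def by (rule cInf_lower) (use that in \<open>auto intro: bdd_belowI[of _ 0]\<close>)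
  have d0: "0 \<le> d" unfolding d_def by (rule cInf_greatest) (use aM in auto)
  have ex: "\<exists>x\<in>M. norm x < d + e" if "e > 0" for e
  proof -
    have "Inf (norm ` M) < d + e" using that by (simp add: d_def)
    then show ?thesis using cInf_lessD[of "norm ` M" "d + e"] aM by auto
  qed
  have "\<forall>n. \<exists>x\<in>M. norm x < d + 1 / Suc n" using ex by simp
  then obtain X where XM: "\<And>n. X n \<in> M" and Xd: "\<And>n. norm (X n) < d + 1 / Suc n" by metis
  have lim: "(\<lambda>n. norm (X n)) \<longlonglongrightarrow> d"
  proof (rule tendsto_sandwich[of "\<lambda>_. d" _ _ "\<lambda>n. d + 1 / Suc n"])
    show "(\<lambda>n. d + 1 / real (Suc n)) \<longlonglongrightarrow> d"
      using tendsto_add[OF tendsto_const[of d] LIMSEQ_inverse_real_of_nat] by (simp add: inverse_eq_divide)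
  qed (use d_le[OF XM] Xd less_imp_le in \<open>auto intro!: always_eventually\<close>)
  have close: "(norm (x - y))\<^sup>2 \<le> 2 * (norm x)\<^sup>2 + 2 * (norm y)\<^sup>2 - 4 * d\<^sup>2" if "x \<in> M" "y \<in> M" for x y
  proof -
    have "(1/2) *\<^sub>C (x + y) \<in> M" using that by (simp add: M_def hom f.add)
    from d_le[OF this] have "2 * d \<le> norm (x + y)" by (simp add: norm_scaleC norm_divide)
    then have "(2 * d)\<^sup>2 \<le> (norm (x + y))\<^sup>2" using d0 by (intro power_mono) auto
    then show ?thesis by (simp add: parallelogram power_mult_distrib)
  qed
  have "Cauchy X"
  proof (rule metric_CauchyI)
    fix e :: real assume e: "0 < e"
    have "(\<lambda>n. (norm (X n))\<^sup>2) \<longlonglongrightarrow> d\<^sup>2" by (intro tendsto_power lim)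
    then have "\<forall>\<^sub>F n in sequentially. (norm (X n))\<^sup>2 < d\<^sup>2 + e\<^sup>2 / 4"
      by (rule order_tendstoD) (use e in simp)
    then obtain N where N: "\<And>n. n \<ge> N \<Longrightarrow> (norm (X n))\<^sup>2 < d\<^sup>2 + e\<^sup>2 / 4"
      by (auto simp: eventually_sequentially)
    show "\<exists>N. \<forall>m\<ge>N. \<forall>n\<ge>N. dist (X m) (X n) < e"
    proof (intro exI allI impI)
      fix m n assume "N \<le> m" "N \<le> n"
      then have "(norm (X m - X n))\<^sup>2 < e\<^sup>2"
        using close[OF XM[of m] XM[of n]] N[of m] N[of n] by linarith
      then show "dist (X m) (X n) < e" using e by (simp add: dist_norm power2_less_imp_less)
    qed
  qed
  then obtain z where z: "X \<longlonglongrightarrow> z" by (auto simp: Cauchy_convergent_iff convergent_def)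
  have fz: "f z = 1"
    using LIMSEQ_unique[OF f.tendsto[OF z]] XM by (simp add: M_def)
  have nz: "norm z = d" using LIMSEQ_unique[OF tendsto_norm[OF z] lim] .
  have z0: "z \<noteq> 0" using fz f.zero by auto
  have orth: "cinner u z = 0" if u: "f u = 0" for u
  proof (cases "u = 0")
    case False
    let ?y = "z - (cinner z u / of_real ((norm u)\<^sup>2)) *\<^sub>C u"
    have "?y \<in> M" by (simp add: M_def f.diff hom fz u)
    then have "(norm z)\<^sup>2 \<le> (norm ?y)\<^sup>2" using d_le nz d0 by (intro power_mono) auto
    then have "(cmod (cinner z u))\<^sup>2 / (norm u)\<^sup>2 \<le> 0"
      unfolding norm_orthogonal_component[OF False] by linarith
    then have "cinner z u = 0" using False by (simp add: divide_le_0_iff)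
    then show ?thesis using cinner_commute[of u z] by simp
  qed simp
  have "f x = cinner x ((1 / of_real ((norm z)\<^sup>2)) *\<^sub>C z)" for x
  proof -
    have "cinner (x - f x *\<^sub>C z) z = 0" by (rule orth) (simp add: f.diff hom fz)
    then have "cinner x z = f x * of_real ((norm z)\<^sup>2)"
      by (simp add: cinner.diff_left cinner_scaleC_left cinner_self)
    then show ?thesis using z0 by (simp add: cinner_scaleC_right)
  qed
  then show ?thesis by blast
qed

lemma bounded_clinear_opsI:
  "(\<And>c x. blinfun_apply T (c *\<^sub>C x) = c *\<^sub>C blinfun_apply T x) \<Longrightarrow> T \<in> bounded_clinear_ops"
  by (simp add: bounded_clinear_ops_def Vector_Spaces.linear_iff blinfun.add_right
      complex_vector.vector_space_axioms)

lemma clinear_scaleC: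
  "T \<in> bounded_clinear_ops \<Longrightarrow> blinfun_apply T (c *\<^sub>C x) = c *\<^sub>C blinfun_apply T x"
  by (simp add: bounded_clinear_ops_def Vector_Spaces.linear_iff)

lemma ex_adjoint:
  fixes T :: "'a::complex_hilbert \<Rightarrow>\<^sub>L 'b::complex_hilbert"
  assumes T: "T \<in> bounded_clinear_ops"
  shows "\<exists>S. \<forall>x y. cinner (blinfun_apply T x) y = cinner x (blinfun_apply S y)"
proof -
  have "\<exists>z. \<forall>x. cinner (blinfun_apply T x) y = cinner x z" for y
    by (rule Riesz_representation)
      (auto intro!: bounded_linear_compose[OF cinner.bounded_linear_left] blinfun.bounded_linear_right
        simp: clinear_scaleC[OF T] cinner_scaleC_left)
  then obtain S where S: "\<And>x y. cinner (blinfun_apply T x) y = cinner x (S y)" by metis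
  have "bounded_linear S"
  proof (rule bounded_linear_intro[where K = "norm T"])
    fix x y :: 'b and r :: real
    show "S (x + y) = S x + S y"
      by (rule cinner_left_eqI) (simp add: cinner_add_right flip: S)
    show "S (r *\<^sub>R x) = r *\<^sub>R S x"
      by (rule cinner_left_eqI) (simp add: cinner.scaleR_right flip: S)
    have "(norm (S x))\<^sup>2 = cmod (cinner (blinfun_apply T (S x)) x)" by (simp add: S cinner_self norm_power)
    also have "\<dots> \<le> norm T * norm (S x) * norm x"
      by (rule order_trans[OF cinner_Cauchy_Schwarz mult_right_mono[OF norm_blinfun]]) simp
    finally show "norm (S x) \<le> norm x * norm T"
      by (cases "S x = 0") (auto simp: power2_eq_square mult.commute)
  qed
  then show ?thesis using S by (intro exI[of _ "Blinfun S"]) (simp add: bounded_linear_Blinfun_apply)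
qed

lemma adjoint_unique:
  fixes T :: "'a::complex_hilbert \<Rightarrow>\<^sub>L 'b::complex_hilbert"
  assumes "\<And>x y. cinner (blinfun_apply T x) y = cinner x (blinfun_apply S y)"
  shows "cadjoint T = S"
  unfolding cadjoint_def
proof (rule the_equality)
  fix S' assume "\<forall>x y. cinner (blinfun_apply T x) y = cinner x (blinfun_apply S' y)"
  then show "S' = S" using assms by - (rule blinfun_eqI, rule cinner_left_eqI, simp)
qed (use assms in blast)

lemma cinner_cadjoint_right:
  "T \<in> bounded_clinear_ops \<Longrightarrow> cinner x (blinfun_apply (cadjoint T) y) = cinner (blinfun_apply T x) y"
  using ex_adjoint adjoint_unique by metis

lemma cinner_cadjoint_left:
  "T \<in> bounded_clinear_ops \<Longrightarrow> cinner (blinfun_apply (cadjoint T) y) x = cinner y (blinfun_apply T x)"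
  using cinner_cadjoint_right[of T x y] cinner_commute by metis

lemma cadjoint_clinear: "T \<in> bounded_clinear_ops \<Longrightarrow> cadjoint T \<in> bounded_clinear_ops"
  by (rule bounded_clinear_opsI, rule cinner_left_eqI)
    (simp add: cinner_cadjoint_right cinner_scaleC_right)

lemma norm_cadjoint_le:
  assumes T: "T \<in> bounded_clinear_ops"
  shows "norm (cadjoint T) \<le> norm T"
proof (rule norm_blinfun_bound)
  fix y
  let ?z = "blinfun_apply (cadjoint T) y"
  have "(norm ?z)\<^sup>2 = cmod (cinner ?z ?z)" by (simp add: cinner_self norm_power)
  also have "\<dots> = cmod (cinner (blinfun_apply T ?z) y)" by (simp add: cinner_cadjoint_right[OF T])
  also have "\<dots> \<le> norm T * norm ?z * norm y"
    by (rule order_trans[OF cinner_Cauchy_Schwarz mult_right_mono[OF norm_blinfun]]) simp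
  finally show "norm ?z \<le> norm T * norm y"
    by (cases "?z = 0") (auto simp: power2_eq_square)
qed simp

lemma cadjoint_cadjoint: "T \<in> bounded_clinear_ops \<Longrightarrow> cadjoint (cadjoint T) = T"
  by (rule adjoint_unique) (rule cinner_cadjoint_left)

lemma clinear_id: "id_blinfun \<in> bounded_clinear_ops"
  by (rule bounded_clinear_opsI) simp

lemma clinear_compose:
  "T \<in> bounded_clinear_ops \<Longrightarrow> S \<in> bounded_clinear_ops \<Longrightarrow> T o\<^sub>L S \<in> bounded_clinear_ops"
  by (rule bounded_clinear_opsI) (simp add: clinear_scaleC)

lemma clinear_scale: "T \<in> bounded_clinear_ops \<Longrightarrow> c *\<^sub>C T \<in> bounded_clinear_ops"
  by (rule bounded_clinear_opsI) (simp add: clinear_scaleC scaleC_blinfun.rep_eq scaleC_scaleC mult.commute)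

lemma cadjoint_add:
  assumes "T \<in> bounded_clinear_ops" "S \<in> bounded_clinear_ops"
  shows "cadjoint (T + S) = cadjoint T + cadjoint S"
  by (rule adjoint_unique)
    (simp add: assms blinfun.add_left cinner_add_left cinner_add_right cinner_cadjoint_right)

lemma cadjoint_scaleC:
  assumes "T \<in> bounded_clinear_ops"
  shows "cadjoint (c *\<^sub>C T) = cnj c *\<^sub>C cadjoint T"
  by (rule adjoint_unique)
    (simp add: assms scaleC_blinfun.rep_eq cinner_scaleC_left cinner_scaleC_right cinner_cadjoint_right)

lemma cadjoint_compose:
  assumes "T \<in> bounded_clinear_ops" "S \<in> bounded_clinear_ops"
  shows "cadjoint (T o\<^sub>L S) = cadjoint S o\<^sub>L cadjoint T"
  by (rule adjoint_unique) (simp add: assms cinner_cadjoint_right)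

section \<open>Power series of operators\<close>

primrec op_pow :: "('a::real_normed_vector \<Rightarrow>\<^sub>L 'a) \<Rightarrow> nat \<Rightarrow> 'a \<Rightarrow>\<^sub>L 'a" where
  "op_pow C 0 = id_blinfun"
| "op_pow C (Suc n) = C o\<^sub>L op_pow C n"

definition op_series :: "(nat \<Rightarrow> real) \<Rightarrow> ('a::real_normed_vector \<Rightarrow>\<^sub>L 'a) \<Rightarrow> 'a \<Rightarrow>\<^sub>L 'a"
  where "op_series a C = (\<Sum>n. a n *\<^sub>R op_pow C n)"

lemma id_compose [simp]: "id_blinfun o\<^sub>L T = T" "T o\<^sub>L id_blinfun = T"
  by (rule blinfun_eqI, simp)+

lemma compose_assoc: "(T o\<^sub>L S) o\<^sub>L R = T o\<^sub>L (S o\<^sub>L R)"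
  by (rule blinfun_eqI) simp

lemma op_pow_add: "op_pow C (m + n) = op_pow C m o\<^sub>L op_pow C n"
  by (induction m) (simp_all add: compose_assoc)

lemma op_pow_Suc_right: "op_pow C (Suc n) = op_pow C n o\<^sub>L C"
  using op_pow_add[of C n 1] by simp

lemma norm_op_pow: "norm (op_pow C n) \<le> norm C ^ n"
proof (induction n)
  case 0
  show ?case by (simp add: norm_blinfun_id_le)
next
  case (Suc n)
  then show ?case using norm_blinfun_compose[of C "op_pow C n"]
    by (simp add: order_trans[OF _ mult_left_mono[OF Suc]])
qed

lemma op_pow_intertwine:
  assumes "B o\<^sub>L C = D o\<^sub>L B"
  shows "B o\<^sub>L op_pow C n = op_pow D n o\<^sub>L B"
proof (induction n)
  case (Suc n)
  have "B o\<^sub>L op_pow C (Suc n) = D o\<^sub>L (B o\<^sub>L op_pow C n)" by (simp add: assms flip: compose_assoc)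
  then show ?case by (simp add: Suc compose_assoc)
qed simp

context
  fixes a :: "nat \<Rightarrow> real" and C :: "'a::banach \<Rightarrow>\<^sub>L 'a"
  assumes a: "\<And>n. \<bar>a n\<bar> \<le> 1" and C: "norm C < 1"
begin

lemma norm_op_series_term: "norm (a n *\<^sub>R op_pow C n) \<le> norm C ^ n"
  using mult_mono[OF a[of n] norm_op_pow[of C n]] by simp

lemma op_series_sums: "(\<lambda>n. a n *\<^sub>R op_pow C n) sums op_series a C"
  unfolding op_series_def
  by (rule summable_sums, rule summable_comparison_test'[OF summable_geometric[of "norm C"]])
    (use C norm_op_series_term in auto)

lemma op_series_apply_sums:
  "(\<lambda>n. a n *\<^sub>R blinfun_apply (op_pow C n) x) sums blinfun_apply (op_series a C) x"
  using bounded_linear.sums[OF blinfun.bounded_linear_left[of x] op_series_sums]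
  by (simp add: blinfun.scaleR_left)

lemma norm_op_series: "norm (op_series a C) \<le> 1 / (1 - norm C)"
  by (rule norm_sums_le[OF op_series_sums geometric_sums norm_op_series_term]) (use C in simp)

text \<open>The Cauchy product formula. The square partial sums and the triangular ones differ by terms
  that are dominated by the corresponding difference for the real power series with coefficients
  \<open>\<bar>a n\<bar>\<close> at the point \<open>norm C\<close>.\<close>

lemma op_series_square:
  "(\<lambda>n. (\<Sum>i\<le>n. a i * a (n - i)) *\<^sub>R op_pow C n) sums (op_series a C o\<^sub>L op_series a C)"
proof -
  define t where "t = norm C"
  have t: "0 \<le> t" "t < 1" using C by (simp_all add: t_def)
  let ?g = "\<lambda>i j. (a i * a j) *\<^sub>R op_pow C (i + j)"
  let ?f = "\<lambda>i j. (\<bar>a i\<bar> * t ^ i) * (\<bar>a j\<bar> * t ^ j)"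
  let ?S = "\<lambda>n. {..<n} \<times> {..<n}" and ?T = "\<lambda>n::nat. {(i, j). i + j < n}"
  define P where "P n = (\<Sum>i<n. a i *\<^sub>R op_pow C i)" for n
  have sq: "P n o\<^sub>L P n = (\<Sum>(i,j)\<in>?S n. ?g i j)" for n
    unfolding P_def blinfun_compose.sum_left blinfun_compose.sum_right
    by (simp add: blinfun_compose.scaleR_left blinfun_compose.scaleR_right sum.cartesian_product add.commute flip: op_pow_add)
  have tri: "(\<Sum>m<n. (\<Sum>i\<le>m. a i * a (m - i)) *\<^sub>R op_pow C m) = (\<Sum>(i,j)\<in>?T n. ?g i j)" for n
    unfolding sum.triangle_reindex by (simp add: scaleR_sum_left)
  have sub: "?T n \<subseteq> ?S n" for n by auto
  have "summable (\<lambda>n. norm (\<bar>a n\<bar> * t ^ n))"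
    by (rule summable_comparison_test'[OF summable_geometric[of t]])
      (use a t in \<open>auto simp: abs_mult intro!: mult_left_le_one_le\<close>)
  note cauchy = Cauchy_product_sums[OF this this] and summ = summable_norm_cancel[OF this]
  have conv: "(\<lambda>n. (\<Sum>(i,j)\<in>?S n. ?f i j) - (\<Sum>(i,j)\<in>?T n. ?f i j)) \<longlonglongrightarrow> 0"
  proof -
    have "(\<lambda>n. (\<Sum>i<n. \<bar>a i\<bar> * t ^ i) * (\<Sum>i<n. \<bar>a i\<bar> * t ^ i) - (\<Sum>(i,j)\<in>?T n. ?f i j))
        \<longlonglongrightarrow> (\<Sum>i. \<bar>a i\<bar> * t ^ i) * (\<Sum>i. \<bar>a i\<bar> * t ^ i) - (\<Sum>i. \<bar>a i\<bar> * t ^ i) * (\<Sum>i. \<bar>a i\<bar> * t ^ i)"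
      using cauchy unfolding sum.triangle_reindex
      by (intro tendsto_diff tendsto_mult summable_LIMSEQ summ) (simp_all add: sums_def)
    then show ?thesis by (simp add: sum_product sum.cartesian_product)
  qed
  have "norm ((P n o\<^sub>L P n) - (\<Sum>m<n. (\<Sum>i\<le>m. a i * a (m - i)) *\<^sub>R op_pow C m))
      \<le> (\<Sum>(i,j)\<in>?S n. ?f i j) - (\<Sum>(i,j)\<in>?T n. ?f i j)" for n
  proof -
    have "norm (\<Sum>(i,j)\<in>?S n - ?T n. ?g i j) \<le> (\<Sum>(i,j)\<in>?S n - ?T n. ?f i j)"
    proof (rule sum_norm_le)
      fix p assume "p \<in> ?S n - ?T n"
      obtain i j where p: "p = (i, j)" by (cases p)
      have "norm (?g i j) = \<bar>a i\<bar> * \<bar>a j\<bar> * norm (op_pow C (i + j))" by (simp add: abs_mult)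
      also have "\<dots> \<le> \<bar>a i\<bar> * \<bar>a j\<bar> * t ^ (i + j)"
        unfolding t_def by (intro mult_left_mono norm_op_pow) simp
      finally have "norm (?g i j) \<le> ?f i j" by (simp add: power_add mult_ac)
      then show "norm (case p of (i, j) \<Rightarrow> ?g i j) \<le> (case p of (i, j) \<Rightarrow> ?f i j)" by (simp add: p)
    qed
    moreover have "(P n o\<^sub>L P n) - (\<Sum>m<n. (\<Sum>i\<le>m. a i * a (m - i)) *\<^sub>R op_pow C m)
        = (\<Sum>(i,j)\<in>?S n - ?T n. ?g i j)"
      unfolding tri sum_diff[OF finite_cartesian_product[OF finite_lessThan finite_lessThan] sub]
      by (simp only: sq)
    ultimately show ?thesis by (simp add: sum_diff sub)
  qed
  then have diff0: "(\<lambda>n. (P n o\<^sub>L P n) - (\<Sum>m<n. (\<Sum>i\<le>m. a i * a (m - i)) *\<^sub>R op_pow C m)) \<longlonglongrightarrow> 0"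
    by (rule Lim_null_comparison[OF always_eventually[OF allI] conv])
  have "P \<longlonglongrightarrow> op_series a C" using op_series_sums by (simp add: sums_def P_def[abs_def])
  then have "(\<lambda>n. P n o\<^sub>L P n) \<longlonglongrightarrow> (op_series a C o\<^sub>L op_series a C)"
    by (intro blinfun_compose.tendsto)
  from tendsto_diff[OF this diff0] show ?thesis by (simp add: sums_def)
qed

end

text \<open>Applied with \<open>C = B\<^sup>* B\<close> and \<open>D = B B\<^sup>*\<close>, this moves \<open>B\<close> past the defect operators.\<close>

lemma op_series_intertwine:
  fixes B :: "'a::banach \<Rightarrow>\<^sub>L 'b::banach"
  assumes "B o\<^sub>L C = D o\<^sub>L B" "\<And>n. \<bar>a n\<bar> \<le> 1" "norm C < 1" "norm D < 1"
  shows "B o\<^sub>L op_series a C = op_series a D o\<^sub>L B"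
proof (rule sums_unique2)
  show "(\<lambda>n. B o\<^sub>L a n *\<^sub>R op_pow C n) sums (B o\<^sub>L op_series a C)"
    by (rule bounded_linear.sums[OF blinfun_compose.bounded_linear_right op_series_sums]) (use assms in auto)
  have "(\<lambda>n. a n *\<^sub>R op_pow D n o\<^sub>L B) sums (op_series a D o\<^sub>L B)"
    by (rule bounded_linear.sums[OF blinfun_compose.bounded_linear_left op_series_sums]) (use assms in auto)
  then show "(\<lambda>n. B o\<^sub>L a n *\<^sub>R op_pow C n) sums (op_series a D o\<^sub>L B)"
    by (simp add: blinfun_compose.scaleR_left blinfun_compose.scaleR_right op_pow_intertwine[OF assms(1)])
qed

text \<open>The Neumann series of the inverse of \<open>1 + M\<close>.\<close>

definition op_inverse :: "('a::banach \<Rightarrow>\<^sub>L 'a) \<Rightarrow> 'a \<Rightarrow>\<^sub>L 'a"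
  where "op_inverse M = op_series (\<lambda>n. (-1) ^ n) M"

lemma op_inverse:
  assumes M: "norm M < 1"
  shows "(id_blinfun + M) o\<^sub>L op_inverse M = id_blinfun" (is ?R)
    and "op_inverse M o\<^sub>L (id_blinfun + M) = id_blinfun" (is ?L)
proof -
  have s: "(\<lambda>n. (-1) ^ n *\<^sub>R op_pow M n) sums op_inverse M"
    unfolding op_inverse_def by (rule op_series_sums) (use M in auto)
  have comm: "M o\<^sub>L op_inverse M = op_inverse M o\<^sub>L M"
    unfolding op_inverse_def by (rule op_series_intertwine) (use M in auto)
  have "(\<lambda>n. (-1) ^ Suc n *\<^sub>R op_pow M (Suc n)) sums (op_inverse M - id_blinfun)"
    using sums_split_initial_segment[OF s, of 1] by simp
  moreover have "(\<lambda>n. - (M o\<^sub>L (-1) ^ n *\<^sub>R op_pow M n)) sums - (M o\<^sub>L op_inverse M)"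
    by (intro sums_minus bounded_linear.sums[OF blinfun_compose.bounded_linear_right s])
  ultimately have "op_inverse M - id_blinfun = - (M o\<^sub>L op_inverse M)"
    by (simp add: blinfun_compose.scaleR_right sums_unique2)
  then have *: "op_inverse M + (M o\<^sub>L op_inverse M) = id_blinfun"
    by (simp add: algebra_simps)
  then show ?R by (simp add: blinfun_compose.add_left)
  from * show ?L by (simp add: blinfun_compose.add_right comm)
qed

lemma norm_op_inverse: "norm M < 1 \<Longrightarrow> norm (op_inverse M) \<le> 1 / (1 - norm M)"
  unfolding op_inverse_def by (rule norm_op_series) auto

lemma op_pow_clinear: "C \<in> bounded_clinear_ops \<Longrightarrow> op_pow C n \<in> bounded_clinear_ops"
  by (induction n) (simp_all add: clinear_id clinear_compose)

lemma op_series_clinear: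
  fixes C :: "'a::complex_hilbert \<Rightarrow>\<^sub>L 'a"
  assumes "C \<in> bounded_clinear_ops" "\<And>n. \<bar>a n\<bar> \<le> 1" "norm C < 1"
  shows "op_series a C \<in> bounded_clinear_ops"
proof (rule bounded_clinear_opsI)
  fix c x
  have "(\<lambda>n. c *\<^sub>C a n *\<^sub>R blinfun_apply (op_pow C n) x) sums (c *\<^sub>C blinfun_apply (op_series a C) x)"
    by (rule bounded_linear.sums[OF scaleC.bounded_linear_right op_series_apply_sums]) (use assms in auto)
  moreover have "(\<lambda>n. a n *\<^sub>R blinfun_apply (op_pow C n) (c *\<^sub>C x)) sums blinfun_apply (op_series a C) (c *\<^sub>C x)"
    by (rule op_series_apply_sums) (use assms in auto)
  ultimately show "blinfun_apply (op_series a C) (c *\<^sub>C x) = c *\<^sub>C blinfun_apply (op_series a C) x"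
    by (simp add: clinear_scaleC[OF op_pow_clinear[OF assms(1)]] scaleC.scaleR_right sums_unique2)
qed

lemma op_series_selfadjoint:
  fixes C :: "'a::complex_hilbert \<Rightarrow>\<^sub>L 'a"
  assumes sa: "\<And>x y. cinner (blinfun_apply C x) y = cinner x (blinfun_apply C y)"
    and ab: "\<And>n. \<bar>a n\<bar> \<le> 1" "norm C < 1"
  shows "cinner (blinfun_apply (op_series a C) x) y = cinner x (blinfun_apply (op_series a C) y)"
proof (rule sums_unique2)
  have pow: "cinner (blinfun_apply (op_pow C n) u) v = cinner u (blinfun_apply (op_pow C n) v)" for n u v
  proof (induction n arbitrary: u)
    case (Suc n)
    have "blinfun_apply (op_pow C (Suc n)) v = blinfun_apply (op_pow C n) (blinfun_apply C v)"
      by (simp only: op_pow_Suc_right) simp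
    then show ?case
      using Suc[of "blinfun_apply C u"] arg_cong[OF op_pow_Suc_right[of C n], of "\<lambda>T. blinfun_apply T u"]
        arg_cong[OF op_pow_Suc_right[of C n], of "\<lambda>T. blinfun_apply T v"]
      by (simp add: sa)
  qed simp
  show "(\<lambda>n. cinner (a n *\<^sub>R blinfun_apply (op_pow C n) x) y) sums cinner (blinfun_apply (op_series a C) x) y"
    by (rule bounded_linear.sums[OF cinner.bounded_linear_left op_series_apply_sums]) (use ab in auto)
  have "(\<lambda>n. cinner x (a n *\<^sub>R blinfun_apply (op_pow C n) y)) sums cinner x (blinfun_apply (op_series a C) y)"
    by (rule bounded_linear.sums[OF cinner.bounded_linear_right op_series_apply_sums]) (use ab in auto)
  then show "(\<lambda>n. cinner (a n *\<^sub>R blinfun_apply (op_pow C n) x) y) sums cinner x (blinfun_apply (op_series a C) y)"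
    by (simp add: cinner.scaleR_left cinner.scaleR_right pow)
qed

text \<open>The Taylor coefficients of \<open>(1 - t)\<^bsup>1/2\<^esup>\<close>.\<close>

definition sqrt_coeff :: "nat \<Rightarrow> real"
  where "sqrt_coeff n = (-1) ^ n * ((1/2) gchoose n)"

lemma abs_sqrt_coeff: "\<bar>sqrt_coeff n\<bar> \<le> 1"
proof -
  have "\<bar>(1/2 :: real) gchoose n\<bar> \<le> 1"
  proof (induction n)
    case (Suc n)
    have "((1/2 :: real) gchoose Suc n) = ((1/2 - real n) / (real n + 1)) * ((1/2) gchoose n)"
      using gbinomial_mult_1[of "1/2 :: real" n] by (simp add: field_simps)
    moreover have "\<bar>(1/2 - real n) / (real n + 1)\<bar> \<le> 1" by (simp add: field_simps abs_le_iff)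
    ultimately show ?case using Suc by (simp only: abs_mult) (rule mult_le_one, auto)
  qed simp
  then show ?thesis by (simp add: sqrt_coeff_def abs_mult)
qed

lemma sqrt_coeff_square:
  "(\<Sum>i\<le>n. sqrt_coeff i * sqrt_coeff (n - i)) = (if n = 0 then 1 else if n = 1 then -1 else 0)"
proof -
  have "(\<Sum>i\<le>n. sqrt_coeff i * sqrt_coeff (n - i))
      = (-1) ^ n * (\<Sum>i\<in>{0..n}. ((1/2) gchoose i) * ((1/2) gchoose (n - i)))"
    unfolding sum_distrib_left atLeast0AtMost
    by (rule sum.cong) (auto simp: sqrt_coeff_def simp flip: power_add)
  also have "\<dots> = (-1) ^ n * ((1 :: real) gchoose n)" by (simp add: gbinomial_Vandermonde)
  also have "(1 :: real) gchoose n = of_nat (1 choose n)" by (simp add: binomial_gbinomial)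
  finally show ?thesis by (auto simp: binomial_eq_0)
qed

definition sqrt_one_minus :: "('a::banach \<Rightarrow>\<^sub>L 'a) \<Rightarrow> 'a \<Rightarrow>\<^sub>L 'a"
  where "sqrt_one_minus C = op_series sqrt_coeff C"

lemma sqrt_one_minus_square:
  assumes "norm C < 1"
  shows "sqrt_one_minus C o\<^sub>L sqrt_one_minus C = id_blinfun - C"
proof (rule sums_unique2)
  show "(\<lambda>n. (\<Sum>i\<le>n. sqrt_coeff i * sqrt_coeff (n - i)) *\<^sub>R op_pow C n) sums (sqrt_one_minus C o\<^sub>L sqrt_one_minus C)"
    unfolding sqrt_one_minus_def by (rule op_series_square) (use assms abs_sqrt_coeff in auto)
  have "(\<lambda>n. (\<Sum>i\<le>n. sqrt_coeff i * sqrt_coeff (n - i)) *\<^sub>R op_pow C n) sums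
      (\<Sum>n\<in>{0,1}. (\<Sum>i\<le>n. sqrt_coeff i * sqrt_coeff (n - i)) *\<^sub>R op_pow C n)"
    by (rule sums_finite) (auto simp: sqrt_coeff_square)
  then show "(\<lambda>n. (\<Sum>i\<le>n. sqrt_coeff i * sqrt_coeff (n - i)) *\<^sub>R op_pow C n) sums (id_blinfun - C)"
    by (simp add: sqrt_coeff_square)
qed

text \<open>Since \<open>1 - C\<close> is invertible, so is its square root, with inverse \<open>(1 - C)\<^bsup>1/2\<^esup> (1 - C)\<^bsup>-1\<^esup>\<close>.\<close>

lemma sqrt_one_minus_invertible:
  assumes C: "norm C < 1"
  obtains Q where "sqrt_one_minus C o\<^sub>L Q = id_blinfun" "Q o\<^sub>L sqrt_one_minus C = id_blinfun"
proof
  let ?S = "sqrt_one_minus C" and ?N = "op_inverse (- C)"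
  have 1: "?S o\<^sub>L (?S o\<^sub>L ?N) = id_blinfun" and 2: "(?N o\<^sub>L ?S) o\<^sub>L ?S = id_blinfun"
    using op_inverse[of "- C"] C sqrt_one_minus_square[OF C] by (simp_all add: compose_assoc flip: compose_assoc[of ?S ?S])
  show "?S o\<^sub>L (?S o\<^sub>L ?N) = id_blinfun" by (rule 1)
  have "?N o\<^sub>L ?S = (?N o\<^sub>L ?S) o\<^sub>L (?S o\<^sub>L (?S o\<^sub>L ?N))" by (simp add: 1)
  also have "\<dots> = ((?N o\<^sub>L ?S) o\<^sub>L ?S) o\<^sub>L (?S o\<^sub>L ?N)" by (simp only: compose_assoc)
  finally have "?N o\<^sub>L ?S = ?S o\<^sub>L ?N" by (simp add: 2)
  with 2 show "(?S o\<^sub>L ?N) o\<^sub>L ?S = id_blinfun" by simp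
qed

section \<open>\<open>J\<^sup>*\<close>-algebras\<close>

locale J_star =
  fixes A :: "('h::complex_hilbert \<Rightarrow>\<^sub>L 'k::complex_hilbert) set"
  assumes J_star: "J_star_algebra A"
begin

lemma clinear: "T \<in> A \<Longrightarrow> T \<in> bounded_clinear_ops"
  using J_star by (auto simp: J_star_algebra_def)

lemma closed: "closed A"
  using J_star by (simp add: J_star_algebra_def)

lemma subspace: "complex_vector.subspace A"
  using J_star by (simp add: J_star_algebra_def)

lemma add: "T \<in> A \<Longrightarrow> S \<in> A \<Longrightarrow> T + S \<in> A"
  by (rule complex_vector.subspace_add[OF subspace])

lemma diff: "T \<in> A \<Longrightarrow> S \<in> A \<Longrightarrow> T - S \<in> A"
  by (rule complex_vector.subspace_diff[OF subspace])

lemma scale: "T \<in> A \<Longrightarrow> c *\<^sub>C T \<in> A"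
  by (rule complex_vector.subspace_scale[OF subspace])

lemma scaleR: "T \<in> A \<Longrightarrow> r *\<^sub>R T \<in> A"
  by (simp add: scaleR_scaleC scale)

lemma zero: "0 \<in> A"
  by (rule complex_vector.subspace_0[OF subspace])

lemma minus: "T \<in> A \<Longrightarrow> - T \<in> A"
  using diff[OF zero] by simp

lemma sums_mem: "f sums T \<Longrightarrow> (\<And>n. f n \<in> A) \<Longrightarrow> T \<in> A"
  unfolding sums_def
  by (rule closed_sequentially[OF closed]) (auto intro!: complex_vector.subspace_sum[OF subspace])

text \<open>Polarization of the cube \<open>T T\<^sup>* T\<close>, averaging over the fourth roots of unity.\<close>

lemma triple:
  assumes T: "T \<in> A" and S: "S \<in> A"
  shows "T o\<^sub>L cadjoint S o\<^sub>L T \<in> A"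
proof -
  define f where "f Z = Z o\<^sub>L cadjoint Z o\<^sub>L Z" for Z :: "'h \<Rightarrow>\<^sub>L 'k"
  have f: "f Z \<in> A" if "Z \<in> A" for Z
    using that J_star by (simp add: J_star_algebra_def f_def)
  note c = clinear[OF T] clinear[OF S]
  have "(f (T + S) - f (T - S)) + \<i> *\<^sub>C (f (T + \<i> *\<^sub>C S) - f (T - \<i> *\<^sub>C S)) = 4 *\<^sub>R (T o\<^sub>L cadjoint S o\<^sub>L T)"
    (is "?l = ?r")
  proof (rule blinfun_eqI)
    fix x
    have cad: "cadjoint (T - Z) = cadjoint T - cadjoint Z" if "Z \<in> bounded_clinear_ops" for Z
      using cadjoint_add[OF c(1) clinear_scale[OF that, of "-1"]] cadjoint_scaleC[OF that, of "-1"]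
      by (simp add: scaleC_minus_one)
    have four: "4 *\<^sub>R y = y + y + y + y" for y :: 'k
      using scaleR_add_left[of 2 2 y] by (simp add: scaleR_2)
    show "blinfun_apply ?l x = blinfun_apply ?r x"
      by (simp add: f_def c clinear_scale cad cadjoint_add cadjoint_scaleC scaleC_blinfun.rep_eq
          blinfun.add_left blinfun.diff_left blinfun.add_right blinfun.diff_right blinfun.scaleR_left
          cadjoint_clinear clinear_scaleC scaleC_add_right scaleC.diff_right scaleC_scaleC
          scaleC.minus_left four)
  qed
  moreover have "?l \<in> A"
    by (intro add diff scale f T S)
  ultimately have "(1/4) *\<^sub>R 4 *\<^sub>R (T o\<^sub>L cadjoint S o\<^sub>L T) \<in> A" using scaleR by metis
  then show ?thesis by simp
qed

lemma triple_symmetric: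
  assumes "T \<in> A" "S \<in> A" "R \<in> A"
  shows "(T o\<^sub>L cadjoint S o\<^sub>L R) + (R o\<^sub>L cadjoint S o\<^sub>L T) \<in> A"
proof -
  have "(T o\<^sub>L cadjoint S o\<^sub>L R) + (R o\<^sub>L cadjoint S o\<^sub>L T)
      = ((T + R) o\<^sub>L cadjoint S o\<^sub>L (T + R)) - (T o\<^sub>L cadjoint S o\<^sub>L T) - (R o\<^sub>L cadjoint S o\<^sub>L R)"
    by (simp add: blinfun_compose.add_left blinfun_compose.add_right)
  then show ?thesis using assms by (simp add: add diff triple)
qed

text \<open>In general neither \<open>L V\<close> nor \<open>V R\<close> belongs to \<open>A\<close>. The condition below is linear in the pair
  \<open>(L, R)\<close> and stable under limits, and it holds for the powers of \<open>B B\<^sup>*\<close> and \<open>B\<^sup>* B\<close>; hence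
  it holds for power series with the same coefficients in these two operators.\<close>

definition balanced :: "('k \<Rightarrow>\<^sub>L 'k) \<Rightarrow> ('h \<Rightarrow>\<^sub>L 'h) \<Rightarrow> bool"
  where "balanced L R \<longleftrightarrow> (\<forall>V\<in>A. (L o\<^sub>L V) + (V o\<^sub>L R) \<in> A)"

text \<open>Write \<open>\<lambda>(V) = L V + V R\<close>. Then \<open>2 L V R\<close> is \<open>\<lambda>(\<lambda>(V))\<close> minus the value at \<open>V\<close> of the
  corresponding map for the pair of squares. This puts sandwiches between two power series into \<open>A\<close>
  without any manipulation of double series.\<close>

lemma balanced_sandwich:
  assumes LR: "balanced L R" and sq: "balanced (L o\<^sub>L L) (R o\<^sub>L R)" and V: "V \<in> A"
  shows "L o\<^sub>L V o\<^sub>L R \<in> A"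
proof -
  define U where "U = (L o\<^sub>L V) + (V o\<^sub>L R)"
  have U: "U \<in> A" using LR V by (simp add: balanced_def U_def)
  have "2 *\<^sub>R (L o\<^sub>L V o\<^sub>L R) = ((L o\<^sub>L U) + (U o\<^sub>L R)) - ((L o\<^sub>L L o\<^sub>L V) + (V o\<^sub>L (R o\<^sub>L R)))"
    by (simp add: U_def blinfun_compose.add_left blinfun_compose.add_right compose_assoc scaleR_2)
  moreover have "\<dots> \<in> A" using LR sq U V by (intro diff) (auto simp: balanced_def)
  ultimately have "(1/2) *\<^sub>R 2 *\<^sub>R (L o\<^sub>L V o\<^sub>L R) \<in> A" using scaleR by metis
  then show ?thesis by simp
qed

text \<open>With \<open>Z = (B B\<^sup>*)\<^sup>m B\<close>, which lies in \<open>A\<close>, one has \<open>(B B\<^sup>*)\<^bsup>m+1\<^esup> = B Z\<^sup>*\<close> and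
  \<open>(B\<^sup>* B)\<^bsup>m+1\<^esup> = Z\<^sup>* B\<close>, so that the expression in question is a symmetrized triple product of
  \<open>B\<close>, \<open>Z\<close> and \<open>V\<close>.\<close>

lemma balanced_op_pow:
  assumes B: "B \<in> A"
  shows "balanced (op_pow (B o\<^sub>L cadjoint B) n) (op_pow (cadjoint B o\<^sub>L B) n)"
proof (cases n)
  case 0
  then show ?thesis by (simp add: balanced_def add)
next
  case (Suc m)
  define Z where "Z n = op_pow (B o\<^sub>L cadjoint B) n o\<^sub>L B" for n
  have b: "B \<in> bounded_clinear_ops" "cadjoint B \<in> bounded_clinear_ops"
    using clinear[OF B] cadjoint_clinear by auto
  have sa: "cadjoint (op_pow (B o\<^sub>L cadjoint B) n) = op_pow (B o\<^sub>L cadjoint B) n" for n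
  proof (induction n)
    case 0
    show ?case by (rule adjoint_unique) simp
  next
    case (Suc n)
    have "cadjoint (op_pow (B o\<^sub>L cadjoint B) (Suc n)) = op_pow (B o\<^sub>L cadjoint B) n o\<^sub>L (B o\<^sub>L cadjoint B)"
      by (simp add: cadjoint_compose cadjoint_cadjoint b clinear_compose op_pow_clinear Suc)
    then show ?case by (simp only: op_pow_Suc_right)
  qed
  have Zadj: "cadjoint (Z n) = cadjoint B o\<^sub>L op_pow (B o\<^sub>L cadjoint B) n" for n
    unfolding Z_def by (simp add: cadjoint_compose b op_pow_clinear clinear_compose sa)
  have ZA: "Z n \<in> A" for n
  proof (induction n)
    case 0
    then show ?case by (simp add: Z_def B)
  next
    case (Suc n)
    have "Z (Suc n) = B o\<^sub>L cadjoint (Z n) o\<^sub>L B"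
      unfolding Zadj by (simp add: Z_def compose_assoc)
    then show ?case by (simp add: triple B Suc)
  qed
  have 1: "op_pow (B o\<^sub>L cadjoint B) (Suc m) = B o\<^sub>L cadjoint (Z m)"
    unfolding Zadj by (simp add: compose_assoc)
  have "op_pow (cadjoint B o\<^sub>L B) (Suc m) = cadjoint B o\<^sub>L (B o\<^sub>L op_pow (cadjoint B o\<^sub>L B) m)"
    by (simp add: compose_assoc)
  also have "B o\<^sub>L op_pow (cadjoint B o\<^sub>L B) m = op_pow (B o\<^sub>L cadjoint B) m o\<^sub>L B"
    by (rule op_pow_intertwine) (simp add: compose_assoc)
  finally have 2: "op_pow (cadjoint B o\<^sub>L B) (Suc m) = cadjoint (Z m) o\<^sub>L B"
    unfolding Zadj by (simp add: compose_assoc)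
  show ?thesis
    unfolding Suc balanced_def 1 2 using triple_symmetric[OF B ZA] by (simp add: compose_assoc)
qed

lemma balanced_op_series:
  assumes B: "B \<in> A" and nB: "norm (B o\<^sub>L cadjoint B) < 1" "norm (cadjoint B o\<^sub>L B) < 1"
    and a: "\<And>n. \<bar>a n\<bar> \<le> 1"
  shows "balanced (op_series a (B o\<^sub>L cadjoint B)) (op_series a (cadjoint B o\<^sub>L B))"
  unfolding balanced_def
proof
  fix V assume V: "V \<in> A"
  let ?L = "op_pow (B o\<^sub>L cadjoint B)" and ?R = "op_pow (cadjoint B o\<^sub>L B)"
  have "(\<lambda>n. (a n *\<^sub>R ?L n o\<^sub>L V) + (V o\<^sub>L a n *\<^sub>R ?R n)) sums
      ((op_series a (B o\<^sub>L cadjoint B) o\<^sub>L V) + (V o\<^sub>L op_series a (cadjoint B o\<^sub>L B)))"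
    by (intro sums_add bounded_linear.sums[OF blinfun_compose.bounded_linear_left]
        bounded_linear.sums[OF blinfun_compose.bounded_linear_right] op_series_sums a nB)
  then show "(op_series a (B o\<^sub>L cadjoint B) o\<^sub>L V) + (V o\<^sub>L op_series a (cadjoint B o\<^sub>L B)) \<in> A"
  proof (rule sums_mem)
    fix n
    have "(a n *\<^sub>R ?L n o\<^sub>L V) + (V o\<^sub>L a n *\<^sub>R ?R n) = a n *\<^sub>R ((?L n o\<^sub>L V) + (V o\<^sub>L ?R n))"
      by (simp add: blinfun_compose.scaleR_left blinfun_compose.scaleR_right scaleR_add_right)
    then show "(a n *\<^sub>R ?L n o\<^sub>L V) + (V o\<^sub>L a n *\<^sub>R ?R n) \<in> A"
      using balanced_op_pow[OF B, of n] V by (simp add: scaleR balanced_def)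
  qed
qed

end

section \<open>Moebius transformations\<close>

definition defect_left :: "('h::complex_hilbert \<Rightarrow>\<^sub>L 'k::complex_hilbert) \<Rightarrow> 'k \<Rightarrow>\<^sub>L 'k"
  where "defect_left B = sqrt_one_minus (B o\<^sub>L cadjoint B)"

definition defect_right :: "('h::complex_hilbert \<Rightarrow>\<^sub>L 'k::complex_hilbert) \<Rightarrow> 'h \<Rightarrow>\<^sub>L 'h"
  where "defect_right B = sqrt_one_minus (cadjoint B o\<^sub>L B)"

text \<open>The transvection of the unit ball that takes \<open>0\<close> to \<open>B\<close>; it equals
  \<open>(1 - B B\<^sup>*)\<^bsup>-1/2\<^esup> (Z + B) (1 + B\<^sup>* Z)\<^bsup>-1\<^esup> (1 - B\<^sup>* B)\<^bsup>1/2\<^esup>\<close>. In the form chosen, the factors next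
  to \<open>Z (1 + B\<^sup>* Z)\<^bsup>-1\<^esup>\<close> are power series with the same coefficients in \<open>B B\<^sup>*\<close> and
  \<open>B\<^sup>* B\<close>, from which membership in a \<open>J\<^sup>*\<close>-algebra can be read off.\<close>

definition op_moebius ::
    "('h::complex_hilbert \<Rightarrow>\<^sub>L 'k::complex_hilbert) \<Rightarrow> ('h \<Rightarrow>\<^sub>L 'k) \<Rightarrow> ('h \<Rightarrow>\<^sub>L 'k)"
  where "op_moebius B Z = B + (defect_left B o\<^sub>L (Z o\<^sub>L op_inverse (cadjoint B o\<^sub>L Z)) o\<^sub>L defect_right B)"

lemma norm_compose_less_1:
  assumes "norm T < 1" "norm S < 1" shows "norm (T o\<^sub>L S) < 1"
proof -
  have "norm T * norm S \<le> norm T" using assms(2) by (simp add: mult_left_le)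
  then show ?thesis using norm_blinfun_compose[of T S] assms(1) by linarith
qed

context
  fixes B :: "'h::complex_hilbert \<Rightarrow>\<^sub>L 'k::complex_hilbert"
  assumes B: "B \<in> bounded_clinear_ops" and nB: "norm B < 1"
begin

lemma norm_cadjoint_less_1: "norm (cadjoint B) < 1"
  using norm_cadjoint_le[OF B] nB by linarith

lemma norm_BB: "norm (B o\<^sub>L cadjoint B) < 1" "norm (cadjoint B o\<^sub>L B) < 1"
  using norm_compose_less_1 nB norm_cadjoint_less_1 by auto

lemma clinear_BB: "B o\<^sub>L cadjoint B \<in> bounded_clinear_ops" "cadjoint B o\<^sub>L B \<in> bounded_clinear_ops"
  using clinear_compose B cadjoint_clinear[OF B] by auto

lemma defect_square:
  "blinfun_apply (defect_left B) (blinfun_apply (defect_left B) y) = y - blinfun_apply B (blinfun_apply (cadjoint B) y)"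
  "blinfun_apply (defect_right B) (blinfun_apply (defect_right B) x) = x - blinfun_apply (cadjoint B) (blinfun_apply B x)"
  using arg_cong[OF sqrt_one_minus_square[OF norm_BB(1)], of "\<lambda>T. blinfun_apply T y"]
    arg_cong[OF sqrt_one_minus_square[OF norm_BB(2)], of "\<lambda>T. blinfun_apply T x"]
  by (simp_all add: defect_left_def defect_right_def blinfun.diff_left)

lemma defect_clinear: "defect_left B \<in> bounded_clinear_ops" "defect_right B \<in> bounded_clinear_ops"
  unfolding defect_left_def defect_right_def sqrt_one_minus_def
  using op_series_clinear[OF clinear_BB(1) abs_sqrt_coeff norm_BB(1)]
    op_series_clinear[OF clinear_BB(2) abs_sqrt_coeff norm_BB(2)] by auto

lemma defect_selfadjoint:
  "cinner (blinfun_apply (defect_left B) y) y' = cinner y (blinfun_apply (defect_left B) y')"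
  "cinner (blinfun_apply (defect_right B) x) x' = cinner x (blinfun_apply (defect_right B) x')"
proof -
  have "cinner (blinfun_apply B (blinfun_apply (cadjoint B) u)) v
      = cinner u (blinfun_apply B (blinfun_apply (cadjoint B) v))" for u v
    by (metis cinner_cadjoint_left[OF B] cinner_cadjoint_right[OF B])
  then show "cinner (blinfun_apply (defect_left B) y) y' = cinner y (blinfun_apply (defect_left B) y')"
    unfolding defect_left_def sqrt_one_minus_def
    by (intro op_series_selfadjoint) (simp_all add: abs_sqrt_coeff norm_BB)
  show "cinner (blinfun_apply (defect_right B) x) x' = cinner x (blinfun_apply (defect_right B) x')"
    unfolding defect_right_def sqrt_one_minus_def
    by (rule op_series_selfadjoint)
      (simp_all add: abs_sqrt_coeff norm_BB cinner_cadjoint_left[OF B] cinner_cadjoint_right[OF B])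
qed

lemma defect_intertwine:
  "blinfun_apply B (blinfun_apply (defect_right B) x) = blinfun_apply (defect_left B) (blinfun_apply B x)"
  "blinfun_apply (cadjoint B) (blinfun_apply (defect_left B) y) = blinfun_apply (defect_right B) (blinfun_apply (cadjoint B) y)"
proof -
  have "B o\<^sub>L defect_right B = defect_left B o\<^sub>L B"
    unfolding defect_left_def defect_right_def sqrt_one_minus_def
    by (rule op_series_intertwine) (simp_all add: abs_sqrt_coeff norm_BB compose_assoc)
  from arg_cong[OF this, of "\<lambda>T. blinfun_apply T x"]
  show "blinfun_apply B (blinfun_apply (defect_right B) x) = blinfun_apply (defect_left B) (blinfun_apply B x)"
    by simp
  have "cadjoint B o\<^sub>L defect_left B = defect_right B o\<^sub>L cadjoint B"
    unfolding defect_left_def defect_right_def sqrt_one_minus_def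
    by (rule op_series_intertwine) (simp_all add: abs_sqrt_coeff norm_BB compose_assoc)
  from arg_cong[OF this, of "\<lambda>T. blinfun_apply T y"]
  show "blinfun_apply (cadjoint B) (blinfun_apply (defect_left B) y) = blinfun_apply (defect_right B) (blinfun_apply (cadjoint B) y)"
    by simp
qed

lemma norm_defect_square:
  "(norm (blinfun_apply (defect_left B) y))\<^sup>2 = (norm y)\<^sup>2 - (norm (blinfun_apply (cadjoint B) y))\<^sup>2"
  "(norm (blinfun_apply (defect_right B) x))\<^sup>2 = (norm x)\<^sup>2 - (norm (blinfun_apply B x))\<^sup>2"
proof -
  have "complex_of_real ((norm (blinfun_apply (defect_left B) y))\<^sup>2)
      = of_real ((norm y)\<^sup>2 - (norm (blinfun_apply (cadjoint B) y))\<^sup>2)"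
    unfolding of_real_diff cinner_self[symmetric]
    by (simp add: defect_selfadjoint(1) defect_square(1) cinner.diff_right flip: cinner_cadjoint_left[OF B])
  then show "(norm (blinfun_apply (defect_left B) y))\<^sup>2 = (norm y)\<^sup>2 - (norm (blinfun_apply (cadjoint B) y))\<^sup>2"
    by (simp only: of_real_eq_iff)
  have "complex_of_real ((norm (blinfun_apply (defect_right B) x))\<^sup>2)
      = of_real ((norm x)\<^sup>2 - (norm (blinfun_apply B x))\<^sup>2)"
    unfolding of_real_diff cinner_self[symmetric]
    by (simp add: defect_selfadjoint(2) defect_square(2) cinner.diff_right cinner_cadjoint_right[OF B])
  then show "(norm (blinfun_apply (defect_right B) x))\<^sup>2 = (norm x)\<^sup>2 - (norm (blinfun_apply B x))\<^sup>2"
    by (simp only: of_real_eq_iff)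
qed

lemma defect_left_inverse:
  obtains Q where "\<And>y. blinfun_apply (defect_left B) (blinfun_apply Q y) = y"
    "\<And>y. blinfun_apply Q (blinfun_apply (defect_left B) y) = y"
proof -
  obtain Q where "defect_left B o\<^sub>L Q = id_blinfun" "Q o\<^sub>L defect_left B = id_blinfun"
    unfolding defect_left_def using sqrt_one_minus_invertible[OF norm_BB(1)] by blast
  then show ?thesis
    using that[of Q] by (metis blinfun_apply_blinfun_compose blinfun_apply_id_blinfun id_apply)
qed

lemma defect_right_inverse:
  obtains Q where "\<And>x. blinfun_apply (defect_right B) (blinfun_apply Q x) = x"
    "\<And>x. blinfun_apply Q (blinfun_apply (defect_right B) x) = x"
proof -
  obtain Q where "defect_right B o\<^sub>L Q = id_blinfun" "Q o\<^sub>L defect_right B = id_blinfun"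
    unfolding defect_right_def using sqrt_one_minus_invertible[OF norm_BB(2)] by blast
  then show ?thesis
    using that[of Q] by (metis blinfun_apply_blinfun_compose blinfun_apply_id_blinfun id_apply)
qed

lemma moebius_inverse_factor:
  assumes "norm Z < 1"
  shows "blinfun_apply (op_inverse (cadjoint B o\<^sub>L Z)) x
      + blinfun_apply (cadjoint B) (blinfun_apply Z (blinfun_apply (op_inverse (cadjoint B o\<^sub>L Z)) x)) = x"
    and "blinfun_apply (op_inverse (cadjoint B o\<^sub>L Z)) (x + blinfun_apply (cadjoint B) (blinfun_apply Z x)) = x"
  using arg_cong[OF op_inverse(1)[OF norm_compose_less_1[OF norm_cadjoint_less_1 assms]], of "\<lambda>T. blinfun_apply T x"]
    arg_cong[OF op_inverse(2)[OF norm_compose_less_1[OF norm_cadjoint_less_1 assms]], of "\<lambda>T. blinfun_apply T x"]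
  by (simp_all add: blinfun.add_left)

text \<open>Let \<open>y\<close> and \<open>w\<close> be the inverse images of \<open>\<xi> x\<close> and \<open>Z (\<xi> x)\<close> under the right and the left
  defect operator. Then \<open>x = y + B\<^sup>* w\<close> is mapped to \<open>B y + w\<close>. In the difference of the squared
  norms the mixed terms cancel; what remains is \<open>(norm y)\<^sup>2 - (norm (B y))\<^sup>2\<close> minus
  \<open>(norm w)\<^sup>2 - (norm (B\<^sup>* w))\<^sup>2\<close>, that is, the squared norms of the defect operators at \<open>y\<close> and
  \<open>w\<close>.\<close>

lemma norm_moebius_square:
  assumes Z: "norm Z < 1"
  defines "\<xi> x \<equiv> blinfun_apply (op_inverse (cadjoint B o\<^sub>L Z)) (blinfun_apply (defect_right B) x)"
  shows "(norm x)\<^sup>2 - (norm (blinfun_apply (op_moebius B Z) x))\<^sup>2 = (norm (\<xi> x))\<^sup>2 - (norm (blinfun_apply Z (\<xi> x)))\<^sup>2"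
proof -
  obtain Ql where Ql: "\<And>y. blinfun_apply (defect_left B) (blinfun_apply Ql y) = y"
    "\<And>y. blinfun_apply Ql (blinfun_apply (defect_left B) y) = y" by (rule defect_left_inverse, rule that)
  obtain Qr where Qr: "\<And>x. blinfun_apply (defect_right B) (blinfun_apply Qr x) = x"
    "\<And>x. blinfun_apply Qr (blinfun_apply (defect_right B) x) = x" by (rule defect_right_inverse, rule that)
  define y where "y = blinfun_apply Qr (\<xi> x)"
  define w where "w = blinfun_apply Ql (blinfun_apply Z (\<xi> x))"
  have Sy: "blinfun_apply (defect_right B) y = \<xi> x" and Sw: "blinfun_apply (defect_left B) w = blinfun_apply Z (\<xi> x)"
    by (simp_all add: y_def w_def Ql Qr)
  have "blinfun_apply (defect_right B) (y + blinfun_apply (cadjoint B) w) = blinfun_apply (defect_right B) x"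
    using moebius_inverse_factor(1)[OF Z, of "blinfun_apply (defect_right B) x"]
    by (simp add: blinfun.add_right Sy Sw \<xi>_def flip: defect_intertwine(2))
  then have x: "x = y + blinfun_apply (cadjoint B) w" using Qr(2) by metis
  have "blinfun_apply (op_moebius B Z) x = blinfun_apply B x + blinfun_apply (defect_left B) (blinfun_apply (defect_left B) w)"
    by (simp add: op_moebius_def blinfun.add_left Sw \<xi>_def)
  also have "\<dots> = blinfun_apply B y + w"
    by (simp add: x blinfun.add_right defect_square)
  finally have W: "blinfun_apply (op_moebius B Z) x = blinfun_apply B y + w" .
  have "(norm x)\<^sup>2 - (norm (blinfun_apply (op_moebius B Z) x))\<^sup>2
      = ((norm y)\<^sup>2 - (norm (blinfun_apply B y))\<^sup>2) - ((norm w)\<^sup>2 - (norm (blinfun_apply (cadjoint B) w))\<^sup>2)"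
    unfolding W by (subst x) (simp add: norm_add_square cinner_cadjoint_right[OF B])
  then show ?thesis by (simp add: Sy Sw flip: norm_defect_square)
qed

text \<open>The square of the norm drops by at least \<open>(1 - (norm Z)\<^sup>2) (norm \<xi>)\<^sup>2\<close>. A strict bound on
  the operator norm needs this to be a fixed fraction of \<open>(norm x)\<^sup>2\<close>, which holds because \<open>x\<close> is the
  image of \<open>\<xi>\<close> under the bounded operator \<open>(1 - B\<^sup>* B)\<^bsup>-1/2\<^esup> (1 + B\<^sup>* Z)\<close>.\<close>

lemma norm_moebius_less_1:
  assumes Z: "norm Z < 1"
  shows "norm (op_moebius B Z) < 1"
proof -
  let ?R = "op_inverse (cadjoint B o\<^sub>L Z)"
  obtain Q where "\<And>x. blinfun_apply (defect_right B) (blinfun_apply Q x) = x"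
    and Q: "\<And>x. blinfun_apply Q (blinfun_apply (defect_right B) x) = x" by (rule defect_right_inverse, rule that)
  \<comment> \<open>The factor \<open>2\<close> bounds the norm of \<open>1 + B\<^sup>* Z\<close>; the summand \<open>1\<close> makes \<open>c \<le> 1\<close>.\<close>
  define q where "q = 2 * (norm Q + 1)"
  have q: "2 \<le> q" by (simp add: q_def)
  define c where "c = (1 - (norm Z)\<^sup>2) / q\<^sup>2"
  have Z2: "(norm Z)\<^sup>2 < 1" using Z by (simp add: power_less_one_iff abs_square_less_1)
  have c0: "0 < c" using Z2 q by (simp add: c_def)
  have "1 \<le> q\<^sup>2" using q by (intro one_le_power) simp
  then have "1 - (norm Z)\<^sup>2 \<le> q\<^sup>2" using zero_le_power2[of "norm Z"] by linarith
  then have c1: "c \<le> 1" using q by (simp add: c_def)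
  have "norm (op_moebius B Z) \<le> sqrt (1 - c)"
  proof (rule norm_blinfun_bound)
    fix x
    define \<xi> where "\<xi> = blinfun_apply ?R (blinfun_apply (defect_right B) x)"
    have "norm (blinfun_apply (cadjoint B o\<^sub>L Z) \<xi>) \<le> norm (cadjoint B o\<^sub>L Z) * norm \<xi>" by (rule norm_blinfun)
    also have "\<dots> \<le> 1 * norm \<xi>"
      using norm_compose_less_1[OF norm_cadjoint_less_1 Z] by (intro mult_right_mono) auto
    finally have "norm (blinfun_apply (defect_right B) x) \<le> 2 * norm \<xi>"
      using moebius_inverse_factor(1)[OF Z, of "blinfun_apply (defect_right B) x"]
        norm_triangle_ineq[of \<xi> "blinfun_apply (cadjoint B) (blinfun_apply Z \<xi>)"] by (simp add: \<xi>_def)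
    then have "norm Q * norm (blinfun_apply (defect_right B) x) \<le> norm Q * (2 * norm \<xi>)"
      by (intro mult_left_mono) auto
    then have "norm x \<le> norm Q * (2 * norm \<xi>)"
      using norm_blinfun[of Q "blinfun_apply (defect_right B) x"] by (simp add: Q)
    also have "\<dots> \<le> q * norm \<xi>" by (simp add: q_def algebra_simps)
    finally have "(norm x)\<^sup>2 \<le> (q * norm \<xi>)\<^sup>2" by (intro power_mono) auto
    then have le: "(norm x)\<^sup>2 / q\<^sup>2 \<le> (norm \<xi>)\<^sup>2" using q by (simp add: field_simps power_mult_distrib)
    have "(norm (blinfun_apply Z \<xi>))\<^sup>2 \<le> (norm Z * norm \<xi>)\<^sup>2" by (intro power_mono norm_blinfun) auto
    then have "(1 - (norm Z)\<^sup>2) * (norm \<xi>)\<^sup>2 \<le> (norm \<xi>)\<^sup>2 - (norm (blinfun_apply Z \<xi>))\<^sup>2"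
      by (simp add: algebra_simps power_mult_distrib)
    moreover have "(1 - (norm Z)\<^sup>2) * ((norm x)\<^sup>2 / q\<^sup>2) \<le> (1 - (norm Z)\<^sup>2) * (norm \<xi>)\<^sup>2"
      using le Z2 by (intro mult_left_mono) auto
    ultimately have "c * (norm x)\<^sup>2 \<le> (norm x)\<^sup>2 - (norm (blinfun_apply (op_moebius B Z) x))\<^sup>2"
      unfolding norm_moebius_square[OF Z] by (simp add: \<xi>_def c_def)
    then have "(norm (blinfun_apply (op_moebius B Z) x))\<^sup>2 \<le> (sqrt (1 - c) * norm x)\<^sup>2"
      using c1 by (simp add: power_mult_distrib algebra_simps)
    then show "norm (blinfun_apply (op_moebius B Z) x) \<le> sqrt (1 - c) * norm x"
      by (rule power2_le_imp_le) (use c1 in simp)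
  qed (use c1 in simp)
  also have "\<dots> < 1" using c0 by simp
  finally show ?thesis .
qed

end

text \<open>The terms \<open>Z (B\<^sup>* Z)\<^sup>n\<close> of the expansion of \<open>Z (1 + B\<^sup>* Z)\<^bsup>-1\<^esup>\<close> are iterated triple products,
  and the sandwich between the defect operators is covered by \<open>balanced_sandwich\<close>.\<close>

lemma (in J_star) moebius_mem:
  assumes B: "B \<in> A" "norm B < 1" and Z: "Z \<in> A" "norm Z < 1"
  shows "op_moebius B Z \<in> A"
proof -
  note b = clinear[OF B(1)] B(2)
  let ?M = "cadjoint B o\<^sub>L Z"
  have M: "norm ?M < 1" by (rule norm_compose_less_1[OF norm_cadjoint_less_1[OF b] Z(2)])
  have pow: "Z o\<^sub>L op_pow ?M n \<in> A" for n
  proof (induction n)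
    case (Suc n)
    have "Z o\<^sub>L op_pow ?M (Suc n) = (1/2) *\<^sub>R ((Z o\<^sub>L cadjoint B o\<^sub>L (Z o\<^sub>L op_pow ?M n)) + ((Z o\<^sub>L op_pow ?M n) o\<^sub>L cadjoint B o\<^sub>L Z))"
      (is "?l = _ *\<^sub>R (?x + ?y)")
    proof -
      have "?x = ?l" by (simp add: compose_assoc)
      moreover have "?y = ?l" by (simp only: op_pow_Suc_right compose_assoc)
      ultimately show ?thesis by (simp flip: scaleR_2)
    qed
    then show ?case using triple_symmetric[OF Z(1) B(1) Suc] scaleR by simp
  qed (simp add: Z)
  have "(\<lambda>n. Z o\<^sub>L (-1) ^ n *\<^sub>R op_pow ?M n) sums (Z o\<^sub>L op_inverse ?M)"
    unfolding op_inverse_def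
    by (intro bounded_linear.sums[OF blinfun_compose.bounded_linear_right op_series_sums]) (use M in auto)
  then have ZR: "Z o\<^sub>L op_inverse ?M \<in> A"
    by (rule sums_mem) (simp add: blinfun_compose.scaleR_right scaleR pow)
  have sq: "balanced (defect_left B o\<^sub>L defect_left B) (defect_right B o\<^sub>L defect_right B)"
    unfolding balanced_def
  proof
    fix V assume V: "V \<in> A"
    have "(defect_left B o\<^sub>L defect_left B o\<^sub>L V) + (V o\<^sub>L (defect_right B o\<^sub>L defect_right B))
        = V + V - ((B o\<^sub>L cadjoint B o\<^sub>L V) + (V o\<^sub>L cadjoint B o\<^sub>L B))"
      unfolding defect_left_def defect_right_def
      by (simp add: sqrt_one_minus_square norm_BB[OF b] blinfun_compose.diff_left blinfun_compose.diff_right compose_assoc)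
    then show "(defect_left B o\<^sub>L defect_left B o\<^sub>L V) + (V o\<^sub>L (defect_right B o\<^sub>L defect_right B)) \<in> A"
      using triple_symmetric[OF B(1) B(1) V] V by (simp add: add diff)
  qed
  have "balanced (defect_left B) (defect_right B)"
    unfolding defect_left_def defect_right_def sqrt_one_minus_def
    by (rule balanced_op_series[OF B(1) norm_BB[OF b] abs_sqrt_coeff])
  from balanced_sandwich[OF this sq ZR] show ?thesis
    by (simp add: op_moebius_def add B)
qed

lemma cadjoint_uminus: "T \<in> bounded_clinear_ops \<Longrightarrow> cadjoint (- T) = - cadjoint T"
  using cadjoint_scaleC[of T "-1"] by (simp add: scaleC_minus_one)

lemma clinear_uminus: "T \<in> bounded_clinear_ops \<Longrightarrow> - T \<in> bounded_clinear_ops"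
  using clinear_scale[of T "-1"] by (simp add: scaleC_minus_one)

context
  fixes B :: "'h::complex_hilbert \<Rightarrow>\<^sub>L 'k::complex_hilbert"
  assumes B: "B \<in> bounded_clinear_ops" and nB: "norm B < 1"
begin

lemma moebius_zero: "op_moebius B 0 = B"
  by (simp add: op_moebius_def blinfun_compose.zero_left blinfun_compose.zero_right)

lemma moebius_inverse:
  assumes Z: "norm Z < 1"
  shows "op_moebius (- B) (op_moebius B Z) = Z"
proof (rule blinfun_eqI)
  fix x
  let ?ap = blinfun_apply
  define R where "R = op_inverse (cadjoint B o\<^sub>L Z)"
  define W where "W = op_moebius B Z"
  have nW: "norm W < 1" unfolding W_def by (rule norm_moebius_less_1[OF B nB Z])
  note mB = clinear_uminus[OF B] nB[folded norm_minus_cancel[of B]]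
  have defect: "defect_left (- B) = defect_left B" "defect_right (- B) = defect_right B"
    by (simp_all add: defect_left_def defect_right_def cadjoint_uminus[OF B] blinfun_compose.minus_left
        blinfun_compose.minus_right)
  obtain Q where Q: "\<And>x. ?ap (defect_right B) (?ap Q x) = x" "\<And>x. ?ap Q (?ap (defect_right B) x) = x"
    by (rule defect_right_inverse[OF B nB], rule that)
  have R: "?ap R u + ?ap (cadjoint B) (?ap Z (?ap R u)) = u" "?ap R (u + ?ap (cadjoint B) (?ap Z u)) = u" for u
    unfolding R_def by (rule moebius_inverse_factor[OF B nB Z])+
  have W: "?ap W u = ?ap B u + ?ap (defect_left B) (?ap Z (?ap R (?ap (defect_right B) u)))" for u
    by (simp add: W_def op_moebius_def R_def blinfun.add_left)
  define v where "v = ?ap (defect_right B) x"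
  \<comment> \<open>\<open>1 - B\<^sup>* W\<close> is \<open>R\<close> sandwiched between two copies of the right defect operator, so that
    its inverse maps \<open>v\<close> to \<open>Q (1 + B\<^sup>* Z) x\<close>.\<close>
  have key: "?ap Z x = - ?ap B x + ?ap (defect_left B) (?ap W (?ap (op_inverse (cadjoint (- B) o\<^sub>L W)) v))"
  proof -
    define u where "u = ?ap Q (x + ?ap (cadjoint B) (?ap Z x))"
    have Su: "?ap (defect_right B) u = x + ?ap (cadjoint B) (?ap Z x)" by (simp add: u_def Q)
    then have RSu: "?ap R (?ap (defect_right B) u) = x" by (simp add: R)
    have Wu: "?ap W u = ?ap B u + ?ap (defect_left B) (?ap Z x)" by (simp add: W RSu)
    have "u - ?ap (cadjoint B) (?ap W u) = v"
    proof -
      have "u - ?ap (cadjoint B) (?ap W u) = ?ap (defect_right B) (?ap (defect_right B) u) - ?ap (cadjoint B) (?ap (defect_left B) (?ap Z x))"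
        unfolding Wu by (simp add: blinfun.add_right defect_square(2)[OF B nB])
      also have "\<dots> = v"
        by (simp add: Su defect_intertwine(2)[OF B nB] blinfun.add_right v_def)
      finally show ?thesis .
    qed
    then have "?ap (op_inverse (cadjoint (- B) o\<^sub>L W)) v = u"
      using moebius_inverse_factor(2)[OF mB nW, of u] by (simp add: cadjoint_uminus[OF B] blinfun.minus_left)
    moreover have "?ap (defect_left B) (?ap W u) = ?ap B x + ?ap Z x"
    proof -
      have "?ap (defect_left B) (?ap B u) = ?ap B (x + ?ap (cadjoint B) (?ap Z x))"
        by (simp add: Su flip: defect_intertwine(1)[OF B nB])
      then show ?thesis unfolding Wu by (simp add: blinfun.add_right defect_square(1)[OF B nB])
    qed
    ultimately show ?thesis by simp
  qed
  show "?ap (op_moebius (- B) (op_moebius B Z)) x = ?ap Z x"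
    unfolding key by (simp add: op_moebius_def[of "- B"] defect W_def[symmetric] blinfun.add_left blinfun.diff_left blinfun.minus_left v_def)
qed

text \<open>The exact difference quotient: letting \<open>Y\<close> tend to \<open>Z\<close> in the outer factors reads off the
  derivative.\<close>

lemma moebius_difference:
  assumes Z: "norm Z < 1" and Y: "norm Y < 1"
  shows "op_moebius B Y - op_moebius B Z = (defect_left B o\<^sub>L op_inverse (Z o\<^sub>L cadjoint B) o\<^sub>L (Y - Z)
      o\<^sub>L op_inverse (cadjoint B o\<^sub>L Y) o\<^sub>L defect_right B)"
proof -
  define R where "R U = op_inverse (cadjoint B o\<^sub>L U)" for U
  define L where "L = op_inverse (Z o\<^sub>L cadjoint B)"
  have inv: "R U + (cadjoint B o\<^sub>L (U o\<^sub>L R U)) = id_blinfun" if "norm U < 1" for U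
    using op_inverse(1)[OF norm_compose_less_1[OF norm_cadjoint_less_1[OF B nB] that]]
    by (simp add: R_def blinfun_compose.add_left compose_assoc)
  have L: "L o\<^sub>L (id_blinfun + (Z o\<^sub>L cadjoint B)) = id_blinfun"
    unfolding L_def by (rule op_inverse(2)[OF norm_compose_less_1[OF Z norm_cadjoint_less_1[OF B nB]]])
  have "(id_blinfun + (Z o\<^sub>L cadjoint B)) o\<^sub>L ((Y o\<^sub>L R Y) - (Z o\<^sub>L R Z))
      = (Y o\<^sub>L R Y) + (Z o\<^sub>L (cadjoint B o\<^sub>L (Y o\<^sub>L R Y))) - (Z o\<^sub>L (R Z + (cadjoint B o\<^sub>L (Z o\<^sub>L R Z))))"
    by (simp add: blinfun_compose.add_left blinfun_compose.add_right blinfun_compose.diff_right compose_assoc)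
  also have "\<dots> = (Y o\<^sub>L R Y) - (Z o\<^sub>L R Y)"
    using arg_cong[OF inv[OF Y], of "\<lambda>T. Z o\<^sub>L T"]
    by (simp add: inv Z blinfun_compose.add_right algebra_simps)
  finally have "L o\<^sub>L ((id_blinfun + (Z o\<^sub>L cadjoint B)) o\<^sub>L ((Y o\<^sub>L R Y) - (Z o\<^sub>L R Z))) = L o\<^sub>L ((Y - Z) o\<^sub>L R Y)"
    by (simp add: blinfun_compose.diff_left)
  then have "(Y o\<^sub>L R Y) - (Z o\<^sub>L R Z) = L o\<^sub>L (Y - Z) o\<^sub>L R Y"
    unfolding compose_assoc[symmetric] L by simp
  then have "defect_left B o\<^sub>L ((Y o\<^sub>L R Y) - (Z o\<^sub>L R Z)) o\<^sub>L defect_right B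
      = defect_left B o\<^sub>L L o\<^sub>L (Y - Z) o\<^sub>L R Y o\<^sub>L defect_right B"
    by (simp add: compose_assoc)
  then show ?thesis
    by (simp add: op_moebius_def R_def L_def blinfun_compose.diff_left blinfun_compose.diff_right)
qed

end

section \<open>Complex differentiability\<close>

text \<open>The clause of \<open>analytic_map\<close> at a single point, with the derivative \<open>D\<close> made explicit.\<close>

definition cderiv ::
    "'a::complex_normed_vector set \<Rightarrow> 'a set \<Rightarrow> ('a \<Rightarrow> 'b::complex_normed_vector) \<Rightarrow> 'a \<Rightarrow> ('a \<Rightarrow> 'b) \<Rightarrow> bool"
  where "cderiv V U f x D \<longleftrightarrow>
    (\<forall>u\<in>V. \<forall>v\<in>V. D (u + v) = D u + D v) \<and>
    (\<forall>c. \<forall>u\<in>V. D (c *\<^sub>C u) = c *\<^sub>C D u) \<and>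
    (\<exists>K. \<forall>u\<in>V. norm (D u) \<le> K * norm u) \<and>
    ((\<lambda>y. norm (f y - f x - D (y - x)) / norm (y - x)) \<longlongrightarrow> 0) (at x within U)"

lemma analytic_map_iff_cderiv: "analytic_map V U f \<longleftrightarrow> (\<forall>x\<in>U. \<exists>D. cderiv V U f x D)"
  by (simp add: analytic_map_def cderiv_def)

lemma cderivI:
  assumes "\<And>u v. u \<in> V \<Longrightarrow> v \<in> V \<Longrightarrow> D (u + v) = D u + D v"
    and "\<And>c u. u \<in> V \<Longrightarrow> D (c *\<^sub>C u) = c *\<^sub>C D u"
    and "\<And>u. u \<in> V \<Longrightarrow> norm (D u) \<le> K * norm u"
    and "\<And>e. e > 0 \<Longrightarrow> \<forall>\<^sub>F y in at x within U. norm (f y - f x - D (y - x)) \<le> e * norm (y - x)"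
  shows "cderiv V U f x D"
proof -
  have "((\<lambda>y. norm (f y - f x - D (y - x)) / norm (y - x)) \<longlongrightarrow> 0) (at x within U)"
  proof (rule tendstoI)
    fix e :: real assume e: "e > 0"
    have "\<forall>\<^sub>F y in at x within U. norm (f y - f x - D (y - x)) \<le> e / 2 * norm (y - x)"
      by (rule assms(4)) (use e in simp)
    moreover have "\<forall>\<^sub>F y in at x within U. y \<noteq> x" by (simp add: eventually_at_filter)
    ultimately show "\<forall>\<^sub>F y in at x within U. dist (norm (f y - f x - D (y - x)) / norm (y - x)) 0 < e"
    proof eventually_elim
      case (elim y)
      then have "norm (f y - f x - D (y - x)) / norm (y - x) \<le> e / 2"
        by (simp add: divide_le_eq)
      then have "norm (f y - f x - D (y - x)) / norm (y - x) < e" using e by linarith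
      then show ?case by (simp add: dist_real_def)
    qed
  qed
  then show ?thesis using assms(1-3) unfolding cderiv_def by blast
qed

lemma cderivD:
  assumes "cderiv V U f x D"
  shows cderiv_add: "\<And>u v. u \<in> V \<Longrightarrow> v \<in> V \<Longrightarrow> D (u + v) = D u + D v"
    and cderiv_scaleC: "\<And>c u. u \<in> V \<Longrightarrow> D (c *\<^sub>C u) = c *\<^sub>C D u"
    and cderiv_error: "\<And>e. e > 0 \<Longrightarrow> \<forall>\<^sub>F y in at x within U. norm (f y - f x - D (y - x)) \<le> e * norm (y - x)"
proof -
  fix e :: real assume "e > 0"
  have "((\<lambda>y. norm (f y - f x - D (y - x)) / norm (y - x)) \<longlongrightarrow> 0) (at x within U)"
    using assms by (simp add: cderiv_def)
  then have "\<forall>\<^sub>F y in at x within U. norm (f y - f x - D (y - x)) / norm (y - x) < e"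
    by (rule order_tendstoD) (rule \<open>e > 0\<close>)
  moreover have "\<forall>\<^sub>F y in at x within U. y \<noteq> x" by (simp add: eventually_at_filter)
  ultimately show "\<forall>\<^sub>F y in at x within U. norm (f y - f x - D (y - x)) \<le> e * norm (y - x)"
    by eventually_elim (simp add: divide_less_eq)
qed (use assms in \<open>auto simp: cderiv_def\<close>)

lemma cderiv_bound:
  assumes "cderiv V U f x D"
  obtains K where "K > 0" "\<And>u. u \<in> V \<Longrightarrow> norm (D u) \<le> K * norm u"
proof -
  obtain K where K: "\<And>u. u \<in> V \<Longrightarrow> norm (D u) \<le> K * norm u"
    using assms unfolding cderiv_def by blast
  show ?thesis
  proof (rule that[of "max K 1"])
    fix u assume "u \<in> V"
    then show "norm (D u) \<le> max K 1 * norm u"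
      using K[of u] mult_right_mono[of K "max K 1" "norm u"] by simp
  qed simp
qed

lemma cderiv_compose:
  assumes f: "cderiv V U f x D" and g: "cderiv V' U' g (f x) E"
    and U: "U \<subseteq> V" "complex_vector.subspace V" "x \<in> U"
    and U': "U' \<subseteq> V'" "complex_vector.subspace V'" and fU: "f ` U \<subseteq> U'"
    and D: "\<And>u. u \<in> V \<Longrightarrow> D u \<in> V'"
  shows "cderiv V U (\<lambda>y. g (f y)) x (\<lambda>u. E (D u))"
proof -
  obtain KD where KD: "KD > 0" "\<And>u. u \<in> V \<Longrightarrow> norm (D u) \<le> KD * norm u" by (rule cderiv_bound[OF f], rule that)
  obtain KE where KE: "KE > 0" "\<And>u. u \<in> V' \<Longrightarrow> norm (E u) \<le> KE * norm u" by (rule cderiv_bound[OF g], rule that)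
  have E_diff: "E (u - v) = E u - E v" if "u \<in> V'" "v \<in> V'" for u v
    using cderiv_add[OF g, of "u - v" v] complex_vector.subspace_diff[OF U'(2)] that by simp
  show ?thesis
  proof (rule cderivI[where K = "KE * KD"])
    fix u assume u: "u \<in> V"
    have "norm (E (D u)) \<le> KE * (KD * norm u)"
      using KE(2)[OF D[OF u]] KD(2)[OF u] KE(1) by (meson less_imp_le mult_left_mono order_trans)
    then show "norm (E (D u)) \<le> KE * KD * norm u" by simp
  next
    fix e :: real assume e: "e > 0"
    \<comment> \<open>The linearization errors of \<open>g\<close> and of \<open>f\<close> each get half of the tolerance; \<open>KD + 1\<close> is a
      Lipschitz constant of \<open>f\<close> near \<open>x\<close>.\<close>
    define e1 where "e1 = e / (2 * (KD + 1))"
    define e2 where "e2 = e / (2 * KE)"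
    have e12: "e1 > 0" "e2 > 0" using e KD(1) KE(1) by (auto simp: e1_def e2_def)
    have ev: "\<forall>\<^sub>F y in at x within U. y \<in> U" by (simp add: eventually_at_filter)
    have bound: "\<forall>\<^sub>F y in at x within U. norm (f y - f x) \<le> (KD + 1) * norm (y - x)"
      using cderiv_error[OF f zero_less_one] ev
    proof (eventually_elim)
      case (elim y)
      then have "y - x \<in> V" using U complex_vector.subspace_diff[OF U(2)] by auto
      then show ?case using elim(1) KD(2)[of "y - x"] norm_triangle_ineq[of "f y - f x - D (y - x)" "D (y - x)"]
        by (simp add: algebra_simps)
    qed
    have "((\<lambda>y. (KD + 1) * norm (y - x)) \<longlongrightarrow> (KD + 1) * norm (x - x)) (at x within U)"
      by (intro tendsto_intros)
    then have "((\<lambda>y. f y - f x) \<longlongrightarrow> 0) (at x within U)"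
      by (intro Lim_null_comparison[OF bound]) simp
    then have f_lim: "(f \<longlongrightarrow> f x) (at x within U)" by (simp add: LIM_zero_iff)
    have g_err: "\<forall>\<^sub>F y in at x within U. norm (g (f y) - g (f x) - E (f y - f x)) \<le> e1 * norm (f y - f x)"
    proof -
      have E0: "E 0 = 0" using E_diff[of 0 0] complex_vector.subspace_0[OF U'(2)] by simp
      obtain d where "d > 0" and d: "\<And>y. y \<in> U' \<Longrightarrow> y \<noteq> f x \<Longrightarrow> dist y (f x) < d \<Longrightarrow>
          norm (g y - g (f x) - E (y - f x)) \<le> e1 * norm (y - f x)"
        using cderiv_error[OF g e12(1)] unfolding eventually_at by blast
      have "\<forall>\<^sub>F y in at x within U. dist (f y) (f x) < d" by (rule tendstoD[OF f_lim \<open>d > 0\<close>])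
      with ev show ?thesis
      proof eventually_elim
        case (elim y)
        show ?case
        proof (cases "f y = f x")
          case True
          then show ?thesis by (simp add: E0)
        next
          case False
          then show ?thesis using d[of "f y"] elim fU by auto
        qed
      qed
    qed
    show "\<forall>\<^sub>F y in at x within U. norm (g (f y) - g (f x) - E (D (y - x))) \<le> e * norm (y - x)"
      using g_err bound cderiv_error[OF f e12(2)] ev
    proof eventually_elim
      case (elim y)
      have V: "y - x \<in> V" using U elim complex_vector.subspace_diff[OF U(2)] by auto
      have V': "f y - f x \<in> V'" using U' U elim fU complex_vector.subspace_diff[OF U'(2)] by blast
      note V'' = complex_vector.subspace_diff[OF U'(2) V' D[OF V]]
      have "norm (g (f y) - g (f x) - E (D (y - x)))
          \<le> norm (g (f y) - g (f x) - E (f y - f x)) + norm (E (f y - f x - D (y - x)))"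
        using norm_triangle_ineq[of "g (f y) - g (f x) - E (f y - f x)" "E (f y - f x - D (y - x))"]
        by (simp add: E_diff V' D V)
      also have "\<dots> \<le> e1 * ((KD + 1) * norm (y - x)) + KE * (e2 * norm (y - x))"
      proof (rule add_mono)
        show "norm (g (f y) - g (f x) - E (f y - f x)) \<le> e1 * ((KD + 1) * norm (y - x))"
          using elim(1) mult_left_mono[OF elim(2), of e1] e12 by linarith
        show "norm (E (f y - f x - D (y - x))) \<le> KE * (e2 * norm (y - x))"
          using KE(2)[OF V''] mult_left_mono[OF elim(3), of KE] KE(1) by linarith
      qed
      also have "\<dots> \<le> e / 2 * norm (y - x) + e / 2 * norm (y - x)"
      proof (rule add_mono)
        show "e1 * ((KD + 1) * norm (y - x)) \<le> e / 2 * norm (y - x)"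
        proof -
          have "e1 * (KD + 1) = e / 2" using KD(1) by (simp add: e1_def field_simps)
          then show ?thesis by (simp only: mult.assoc[symmetric] order_refl)
        qed
        have "KE * e2 \<le> KE * (e / (2 * KE))" using KE(1) by (intro mult_left_mono) (auto simp: e2_def)
        also have "\<dots> = e / 2" using KE(1) by simp
        finally show "KE * (e2 * norm (y - x)) \<le> e / 2 * norm (y - x)"
          using mult_right_mono[of "KE * e2" "e / 2" "norm (y - x)"] by (simp add: mult.assoc)
      qed
      finally show ?case by simp
    qed
  qed (auto simp: cderiv_add[OF g] cderiv_add[OF f] cderiv_scaleC[OF f] cderiv_scaleC[OF g] D)
qed

text \<open>Derivatives are limits of difference quotients, which lie in \<open>W\<close>. This is needed for the chain
  rule, where the derivative of the outer map is controlled only on the ambient space of its domain.\<close>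

lemma cderiv_mem:
  assumes f: "cderiv V U f x D" and W: "closed W" "complex_vector.subspace W"
    and fW: "\<And>y. y \<in> U \<Longrightarrow> f y \<in> W" and x: "x \<in> U" and u: "u \<in> V"
    and ev: "\<forall>\<^sub>F t in at_right (0::real). x + t *\<^sub>R u \<in> U"
  shows "D u \<in> W"
proof (cases "u = 0")
  case True
  then have "D u = 0" using cderiv_scaleC[OF f u, of 0] by simp
  then show ?thesis using complex_vector.subspace_0[OF W(2)] by simp
next
  case False
  have lim: "filterlim (\<lambda>t. x + t *\<^sub>R u) (at x within U) (at_right (0::real))"
    unfolding filterlim_at
  proof
    show "\<forall>\<^sub>F t in at_right (0::real). x + t *\<^sub>R u \<in> U \<and> x + t *\<^sub>R u \<noteq> x"
      using ev eventually_at_right_less[of 0] by eventually_elim (use False in auto)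
    have "((\<lambda>t. x + t *\<^sub>R u) \<longlongrightarrow> x + 0 *\<^sub>R u) (at_right (0::real))" by (intro tendsto_intros)
    then show "((\<lambda>t. x + t *\<^sub>R u) \<longlongrightarrow> x) (at_right (0::real))" by simp
  qed
  show ?thesis
    unfolding closed_approachable[OF W(1), symmetric]
  proof (intro allI impI)
    fix e :: real assume e: "e > 0"
    define e' where "e' = e / (2 * norm u)"
    have e': "e' > 0" using e False by (simp add: e'_def)
    have "\<forall>\<^sub>F t in at_right (0::real). norm (f (x + t *\<^sub>R u) - f x - D (x + t *\<^sub>R u - x)) \<le> e' * norm (x + t *\<^sub>R u - x)"
      using filterlim_iff[THEN iffD1, OF lim] cderiv_error[OF f e'] by blast
    with ev eventually_at_right_less[of 0]
    have "\<forall>\<^sub>F t in at_right (0::real). 0 < t \<and> x + t *\<^sub>R u \<in> U \<and>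
        norm (f (x + t *\<^sub>R u) - f x - D (x + t *\<^sub>R u - x)) \<le> e' * norm (x + t *\<^sub>R u - x)"
      by eventually_elim auto
    then obtain t where t: "0 < t" "x + t *\<^sub>R u \<in> U"
      and err: "norm (f (x + t *\<^sub>R u) - f x - D (x + t *\<^sub>R u - x)) \<le> e' * norm (x + t *\<^sub>R u - x)"
      using eventually_happens[of _ "at_right (0::real)"] by force
    let ?w = "(1 / t) *\<^sub>R (f (x + t *\<^sub>R u) - f x)"
    have "?w \<in> W"
      unfolding scaleR_scaleC[of "1 / t"] by (intro complex_vector.subspace_scale[OF W(2)] complex_vector.subspace_diff[OF W(2)] fW t x)
    have "D (t *\<^sub>R u) = t *\<^sub>R D u" using cderiv_scaleC[OF f u] by (simp add: scaleR_scaleC)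
    then have "t *\<^sub>R (?w - D u) = f (x + t *\<^sub>R u) - f x - D (x + t *\<^sub>R u - x)"
      using t(1) by (simp add: scaleR_diff_right)
    then have "t * norm (?w - D u) = norm (f (x + t *\<^sub>R u) - f x - D (x + t *\<^sub>R u - x))"
      using t(1) by (metis norm_scaleR abs_of_pos)
    also have "\<dots> \<le> t * (e / 2)" using err t(1) False by (simp add: e'_def mult.commute)
    finally have "norm (?w - D u) \<le> e / 2" using t(1) by simp
    then show "\<exists>w\<in>W. dist w (D u) < e"
      using \<open>?w \<in> W\<close> e by (intro bexI[of _ ?w]) (auto simp: dist_norm)
  qed
qed

lemma eventually_open_unit_ball:
  assumes "complex_vector.subspace V" "x \<in> open_unit_ball V" "u \<in> V"
  shows "\<forall>\<^sub>F t in at_right (0::real). x + t *\<^sub>R u \<in> open_unit_ball V"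
proof -
  have "((\<lambda>t. norm (x + t *\<^sub>R u)) \<longlongrightarrow> norm (x + 0 *\<^sub>R u)) (at_right (0::real))" by (intro tendsto_intros)
  then have "\<forall>\<^sub>F t in at_right (0::real). norm (x + t *\<^sub>R u) < 1"
    by (rule order_tendstoD) (use assms in \<open>simp add: open_unit_ball_def\<close>)
  then show ?thesis
    by eventually_elim (use assms in \<open>auto simp: open_unit_ball_def scaleR_scaleC
      intro!: complex_vector.subspace_add complex_vector.subspace_scale\<close>)
qed

lemma analytic_map_compose:
  assumes f: "analytic_map V U f" and g: "analytic_map V' U' g"
    and U: "U \<subseteq> V" "complex_vector.subspace V"
    and U': "U' \<subseteq> V'" "complex_vector.subspace V'" "closed V'" and fU: "f ` U \<subseteq> U'"
    and ev: "\<And>x u. x \<in> U \<Longrightarrow> u \<in> V \<Longrightarrow> \<forall>\<^sub>F t in at_right (0::real). x + t *\<^sub>R u \<in> U"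
  shows "analytic_map V U (\<lambda>y. g (f y))"
  unfolding analytic_map_iff_cderiv
proof
  fix x assume x: "x \<in> U"
  obtain D where D: "cderiv V U f x D" using f x by (auto simp: analytic_map_iff_cderiv)
  obtain E where E: "cderiv V' U' g (f x) E" using g x fU by (auto simp: analytic_map_iff_cderiv)
  have "D u \<in> V'" if "u \<in> V" for u
    by (rule cderiv_mem[OF D U'(3,2) _ x that ev[OF x that]]) (use fU U'(1) in auto)
  then show "\<exists>D. cderiv V U (\<lambda>y. g (f y)) x D"
    using cderiv_compose[OF D E U x U'(1,2) fU] by blast
qed

lemma (in J_star) moebius_analytic:
  assumes B: "B \<in> A" "norm B < 1"
  shows "analytic_map A (open_unit_ball A) (op_moebius B)"
  unfolding analytic_map_iff_cderiv
proof
  fix Z assume "Z \<in> open_unit_ball A"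
  then have Z: "Z \<in> A" "norm Z < 1" by (auto simp: open_unit_ball_def)
  note b = clinear[OF B(1)] B(2)
  define c where "c = cadjoint B"
  have c: "c \<in> bounded_clinear_ops" "norm c < 1"
    using cadjoint_clinear[OF b(1)] norm_cadjoint_less_1[OF b] by (auto simp: c_def)
  define L where "L = defect_left B o\<^sub>L op_inverse (Z o\<^sub>L c)"
  define R where "R Y = op_inverse (c o\<^sub>L Y)" for Y
  define S where "S = defect_right B"
  define k where "k = 1 / (1 - norm c)"
  have k: "k > 0" using c by (simp add: k_def)
  have cY: "norm (c o\<^sub>L Y) < 1" if "norm Y < 1" for Y by (rule norm_compose_less_1[OF c(2) that])
  have nR: "norm (R Y) \<le> k" if "norm Y < 1" for Y
  proof -
    have "norm (c o\<^sub>L Y) \<le> norm c"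
      using norm_blinfun_compose[of c Y] mult_left_le[of "norm Y" "norm c"] that by simp
    then have "1 / (1 - norm (c o\<^sub>L Y)) \<le> k" unfolding k_def using c by (intro divide_left_mono) auto
    then show ?thesis using norm_op_inverse[OF cY[OF that]] by (simp add: R_def)
  qed
  have R_diff: "R Y - R Z = - (R Y o\<^sub>L c o\<^sub>L (Y - Z) o\<^sub>L R Z)" if "norm Y < 1" for Y
  proof -
    have "R Y - R Z = (R Y o\<^sub>L ((id_blinfun + (c o\<^sub>L Z)) o\<^sub>L R Z)) - ((R Y o\<^sub>L (id_blinfun + (c o\<^sub>L Y))) o\<^sub>L R Z)"
      unfolding R_def op_inverse(1)[OF cY[OF Z(2)]] op_inverse(2)[OF cY[OF that]] by simp
    then show ?thesis
      by (simp add: compose_assoc blinfun_compose.add_left blinfun_compose.add_right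
          blinfun_compose.diff_left blinfun_compose.diff_right)
  qed
  have Lc: "L \<in> bounded_clinear_ops"
    unfolding L_def op_inverse_def
    using clinear_compose[OF clinear[OF Z(1)] c(1)] norm_compose_less_1[OF Z(2) c(2)]
    by (intro clinear_compose defect_clinear(1)[OF b] op_series_clinear) (auto intro: c clinear Z)
  let ?D = "\<lambda>V. L o\<^sub>L V o\<^sub>L R Z o\<^sub>L S"
  have "cderiv A (open_unit_ball A) (op_moebius B) Z ?D"
  proof (rule cderivI[where K = "norm L * norm (R Z) * norm S"])
    fix V W a
    show "?D (V + W) = ?D V + ?D W" by (simp add: blinfun_compose.add_left blinfun_compose.add_right)
    show "?D (a *\<^sub>C V) = a *\<^sub>C ?D V"
      by (rule blinfun_eqI) (simp add: scaleC_blinfun.rep_eq clinear_scaleC[OF Lc])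
    have "norm (?D V) \<le> norm L * norm V * norm (R Z) * norm S"
      by (intro order_trans[OF norm_blinfun_compose] mult_right_mono norm_blinfun_compose) auto
    then show "norm (?D V) \<le> norm L * norm (R Z) * norm S * norm V" by (simp add: mult_ac)
  next
    fix e :: real assume e: "e > 0"
    define K where "K = norm L * k * norm c * k * norm S"
    have err: "norm (op_moebius B Y - op_moebius B Z - ?D (Y - Z)) \<le> (K * norm (Y - Z)) * norm (Y - Z)"
      if Y: "norm Y < 1" for Y
    proof -
      have "op_moebius B Y - op_moebius B Z - ?D (Y - Z) = L o\<^sub>L (Y - Z) o\<^sub>L (R Y - R Z) o\<^sub>L S"
        unfolding moebius_difference[OF b Z(2) Y]
        by (simp add: L_def R_def S_def c_def blinfun_compose.diff_left blinfun_compose.diff_right compose_assoc)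
      also have "\<dots> = - (L o\<^sub>L (Y - Z) o\<^sub>L (R Y o\<^sub>L c o\<^sub>L (Y - Z) o\<^sub>L R Z) o\<^sub>L S)"
        by (simp add: R_diff[OF Y] blinfun_compose.minus_left blinfun_compose.minus_right)
      also have "norm \<dots> \<le> norm L * norm (Y - Z) * (norm (R Y) * norm c * norm (Y - Z) * norm (R Z)) * norm S"
        unfolding norm_minus_cancel
        by (intro order_trans[OF norm_blinfun_compose] mult_mono norm_blinfun_compose) auto
      also have "\<dots> \<le> norm L * norm (Y - Z) * (k * norm c * norm (Y - Z) * k) * norm S"
        by (intro mult_right_mono mult_left_mono mult_mono nR Y Z) (use k in auto)
      finally show ?thesis by (simp add: K_def mult_ac)
    qed
    have "((\<lambda>Y. K * norm (Y - Z)) \<longlongrightarrow> K * norm (Z - Z)) (at Z within open_unit_ball A)" by (intro tendsto_intros)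
    then have "\<forall>\<^sub>F Y in at Z within open_unit_ball A. K * norm (Y - Z) < e"
      by (rule order_tendstoD) (use e in simp)
    moreover have "\<forall>\<^sub>F Y in at Z within open_unit_ball A. norm Y < 1"
      by (simp add: eventually_at_filter open_unit_ball_def)
    ultimately show "\<forall>\<^sub>F Y in at Z within open_unit_ball A.
        norm (op_moebius B Y - op_moebius B Z - ?D (Y - Z)) \<le> e * norm (Y - Z)"
    proof eventually_elim
      case (elim Y)
      then show ?case by (intro order_trans[OF err[OF elim(2)]] mult_right_mono) auto
    qed
  qed
  then show "\<exists>D. cderiv A (open_unit_ball A) (op_moebius B) Z D" by blast
qed

section \<open>Analytic discs and the Schwarz lemma\<close>

lemma cderiv_imp_DERIV:
  assumes g: "cderiv UNIV (ball 0 1) g w D" and w: "w \<in> ball (0::complex) 1"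
  shows "(g has_field_derivative D 1) (at w)"
proof -
  have D: "D u = u * D 1" for u using cderiv_scaleC[OF g, of 1 u] by simp
  have "((\<lambda>y. norm (g y - g w - D (y - w)) / norm (y - w)) \<longlongrightarrow> 0) (at w)"
    using g at_within_open[OF w open_ball] by (simp add: cderiv_def)
  then have "((\<lambda>y. norm ((g y - g w) / (y - w) - D 1)) \<longlongrightarrow> 0) (at w)"
  proof (rule Lim_transform_eventually)
    have "\<forall>\<^sub>F y in at w. y \<noteq> w" by (simp add: eventually_at_filter)
    then show "\<forall>\<^sub>F y in at w. norm (g y - g w - D (y - w)) / norm (y - w) = norm ((g y - g w) / (y - w) - D 1)"
    proof eventually_elim
      case (elim y)
      then have "(g y - g w) / (y - w) - D 1 = (g y - g w - D (y - w)) / (y - w)"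
        by (simp add: D[of "y - w"] field_simps)
      then show ?case by (simp add: norm_divide)
    qed
  qed
  then show ?thesis
    by (simp add: has_field_derivative_iff tendsto_norm_zero_iff LIM_zero_iff)
qed

lemma cderiv_linear:
  assumes "bounded_linear \<phi>" "\<And>c x. \<phi> (c *\<^sub>C x) = c *\<^sub>C \<phi> x"
  shows "cderiv V U \<phi> x \<phi>"
proof -
  interpret bounded_linear \<phi> by fact
  obtain K where "\<And>x. norm (\<phi> x) \<le> norm x * K" using bounded by blast
  then show ?thesis
    by (intro cderivI[where K = K]) (auto simp: add diff assms mult.commute)
qed

lemma cderiv_line: "cderiv V U (\<lambda>c. c *\<^sub>C u) w (\<lambda>c. c *\<^sub>C u)"
  by (rule cderiv_linear[OF scaleC.bounded_linear_left]) (simp add: scaleC_scaleC)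

lemma cderiv_compose_disc:
  assumes "cderiv UNIV (ball 0 1) \<gamma> w D" "cderiv V' U' g (\<gamma> w) E" "w \<in> ball (0::complex) 1"
    and "U' \<subseteq> V'" "complex_vector.subspace V'" "\<gamma> ` ball 0 1 \<subseteq> U'" "D 1 \<in> V'"
  shows "cderiv UNIV (ball 0 1) (\<lambda>c. g (\<gamma> c)) w (\<lambda>c. E (D c))"
proof (rule cderiv_compose[OF assms(1,2) _ _ assms(3-6)])
  fix u
  show "D u \<in> V'"
    using cderiv_scaleC[OF assms(1), of 1 u] complex_vector.subspace_scale[OF assms(5,7), of u] by simp
qed auto

lemma subspace_UNIV: "complex_vector.subspace UNIV"
  by (simp add: complex_vector.subspace_def)

text \<open>The scalar Schwarz lemma, applied to the matrix coefficient of \<open>\<gamma>\<close> at \<open>x\<close> and the direction of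
  the image of \<open>x\<close> under \<open>D 1\<close>.\<close>

lemma Schwarz_operator_disc:
  fixes \<gamma> :: "complex \<Rightarrow> ('h::complex_hilbert \<Rightarrow>\<^sub>L 'k::complex_hilbert)"
  assumes \<gamma>: "analytic_map UNIV (ball 0 1) \<gamma>" and ball: "\<And>c. cmod c < 1 \<Longrightarrow> norm (\<gamma> c) < 1"
    and 0: "\<gamma> 0 = 0" and D: "cderiv UNIV (ball 0 1) \<gamma> 0 D"
  shows "norm (D 1) \<le> 1"
proof (rule norm_blinfun_bound)
  fix x
  let ?y = "blinfun_apply (D 1) x"
  show "norm ?y \<le> 1 * norm x"
  proof (cases "?y = 0")
    case False
    then have x: "x \<noteq> 0" by auto
    define r where "r = complex_of_real (norm x * norm ?y)"
    define \<phi> where "\<phi> T = (1 / r) * cinner (blinfun_apply T x) ?y" for T :: "'h \<Rightarrow>\<^sub>L 'k"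
    have bl: "bounded_linear \<phi>"
      unfolding \<phi>_def
      by (intro bounded_linear_compose[OF bounded_linear_mult_right]
          bounded_linear_compose[OF cinner.bounded_linear_left] blinfun.bounded_linear_left)
    have \<phi>: "cderiv UNIV UNIV \<phi> T \<phi>" for T
      by (rule cderiv_linear[OF bl]) (simp add: \<phi>_def scaleC_blinfun.rep_eq cinner_scaleC_left)
    have comp: "cderiv UNIV (ball 0 1) (\<lambda>c. \<phi> (\<gamma> c)) w (\<lambda>c. \<phi> (E c))"
      if "cderiv UNIV (ball 0 1) \<gamma> w E" "w \<in> ball 0 1" for w E
      by (rule cderiv_compose_disc[OF that(1) \<phi> that(2)]) auto
    have "(\<lambda>c. \<phi> (\<gamma> c)) holomorphic_on ball 0 1"
      unfolding holomorphic_on_open[OF open_ball]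
      using \<gamma> comp cderiv_imp_DERIV by (metis analytic_map_iff_cderiv)
    moreover have "cmod (\<phi> (\<gamma> c)) < 1" if "norm c < 1" for c
    proof -
      have "cmod (cinner (blinfun_apply (\<gamma> c) x) ?y) \<le> norm (\<gamma> c) * norm x * norm ?y"
        by (rule order_trans[OF cinner_Cauchy_Schwarz mult_right_mono[OF norm_blinfun]]) simp
      also have "\<dots> < 1 * (norm x * norm ?y)"
        unfolding mult.assoc by (rule mult_strict_right_mono[OF ball[OF that]]) (use x False in simp)
      finally show ?thesis using x False by (simp add: \<phi>_def r_def norm_mult norm_divide field_simps)
    qed
    moreover have "\<phi> (\<gamma> 0) = 0" by (simp add: 0 \<phi>_def)
    moreover have "deriv (\<lambda>c. \<phi> (\<gamma> c)) 0 = \<phi> (D 1)"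
      by (rule DERIV_imp_deriv, rule cderiv_imp_DERIV[OF comp[OF D]]) auto
    ultimately have "cmod (\<phi> (D 1)) \<le> 1"
      using Schwarz_Lemma(2)[of "\<lambda>c. \<phi> (\<gamma> c)" 0] by simp
    then show ?thesis using x False
      by (simp add: \<phi>_def r_def cinner_self norm_mult norm_divide norm_power power2_eq_square field_simps)
  qed simp
qed simp

section \<open>The tetrablock\<close>

lemma vec_nth_scaleC: "(c *\<^sub>C x) $ i = c *\<^sub>C (x $ i)"
  by (simp add: scaleC_vec_def)

text \<open>By compactness of the closed bidisc, the polynomial that defines the tetrablock is bounded away
  from \<open>0\<close> on it.\<close>

lemma tetrablock_eventually:
  assumes x: "x \<in> tetrablock"
  shows "\<forall>\<^sub>F t in at_right (0::real). x + t *\<^sub>R u \<in> tetrablock"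
proof -
  define p where "p y q = 1 - y $ 1 * fst q - y $ 2 * snd q + y $ 3 * fst q * snd q"
    for y :: "complex ^ 3" and q :: "complex \<times> complex"
  let ?K = "cball 0 1 \<times> cball 0 1 :: (complex \<times> complex) set"
  have "compact ?K" by (intro compact_Times compact_cball)
  moreover have "continuous_on ?K (\<lambda>q. cmod (p x q))"
    unfolding p_def by (intro continuous_intros)
  moreover have "?K \<noteq> {}" by simp
  ultimately obtain q0 where q0: "q0 \<in> ?K" and min: "\<And>q. q \<in> ?K \<Longrightarrow> cmod (p x q0) \<le> cmod (p x q)"
    using continuous_attains_inf[of ?K "\<lambda>q. cmod (p x q)"] by blast
  define m where "m = cmod (p x q0)"
  have m: "m > 0" using x q0 by (auto simp: m_def p_def tetrablock_def)
  define s where "s = cmod (u $ 1) + cmod (u $ 2) + cmod (u $ 3) + 1"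
  have s: "s > 0" unfolding s_def by (simp add: add_nonneg_pos)
  have "\<forall>\<^sub>F t in at_right (0::real). t < m / s"
    using m s by (intro order_tendstoD(2)[OF tendsto_ident_at]) simp
  then show ?thesis using eventually_at_right_less[of "0::real"]
  proof eventually_elim
    case (elim t)
    have "p (x + t *\<^sub>R u) (z, w) \<noteq> 0" if zw: "cmod z \<le> 1" "cmod w \<le> 1" for z w
    proof
      assume 0: "p (x + t *\<^sub>R u) (z, w) = 0"
      have le: "cmod (a * b) \<le> cmod a" if "cmod b \<le> 1" for a b
        using that by (simp add: norm_mult mult_left_le)
      have "p x (z, w) = t *\<^sub>R (u $ 1 * z + u $ 2 * w - u $ 3 * (z * w))"
        using 0 by (simp add: p_def algebra_simps)
      then have "cmod (p x (z, w)) \<le> t * (cmod (u $ 1 * z) + cmod (u $ 2 * w) + cmod (u $ 3 * (z * w)))"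
        using elim by (simp add: norm_triangle_le norm_triangle_le_diff)
      also have "\<dots> \<le> t * s"
        unfolding s_def using elim le[OF zw(1), of "u $ 1"] le[OF zw(2), of "u $ 2"]
          le[of "z * w" "u $ 3"] zw by (intro mult_left_mono) (auto simp: norm_mult mult_le_one)
      also have "\<dots> < m" using elim s by (simp add: field_simps)
      finally show False using min[of "(z, w)"] zw by (simp add: m_def)
    qed
    then show ?case by (simp add: tetrablock_def p_def)
  qed
qed

lemma axis_in_tetrablock:
  assumes "cmod c < 1"
  shows "c *\<^sub>C axis 1 1 \<in> tetrablock" "c *\<^sub>C axis 3 1 \<in> tetrablock"
proof -
  have *: "1 - c * z \<noteq> 0" "1 + c * z \<noteq> 0" if "cmod z \<le> 1" for z
  proof -
    have "cmod (c * z) < 1"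
      using assms that mult_left_le[of "cmod z" "cmod c"] by (simp add: norm_mult)
    then have "c * z \<noteq> 1" "c * z \<noteq> - 1" by auto
    then show "1 - c * z \<noteq> 0" "1 + c * z \<noteq> 0"
      by (simp_all add: add_eq_0_iff)
  qed
  show "c *\<^sub>C axis 1 1 \<in> tetrablock"
    using * by (auto simp: tetrablock_def vec_nth_scaleC axis_def)
  show "c *\<^sub>C axis 3 1 \<in> tetrablock"
    using *(2) by (auto simp: tetrablock_def vec_nth_scaleC axis_def mult.assoc norm_mult mult_le_one)
qed

text \<open>The defining polynomial is \<open>(1 - z x\<^sub>2) - w (x\<^sub>1 - z x\<^sub>3)\<close>. It vanishes for some \<open>w\<close> in the
  closed disc unless \<open>x\<^sub>1 - z x\<^sub>3\<close> has smaller modulus than \<open>1 - z x\<^sub>2\<close>.\<close>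

lemma tetrablock_disc_function:
  assumes x: "x \<in> tetrablock" and z: "cmod z \<le> 1"
  shows "1 - z * x $ 2 \<noteq> 0" and "cmod ((x $ 1 - z * x $ 3) / (1 - z * x $ 2)) < 1"
proof -
  have nz: "1 - x $ 1 * w - x $ 2 * z + x $ 3 * w * z \<noteq> 0" if "cmod w \<le> 1" for w
    using x z that by (simp add: tetrablock_def)
  show ne: "1 - z * x $ 2 \<noteq> 0" using nz[of 0] by (simp add: mult.commute)
  show "cmod ((x $ 1 - z * x $ 3) / (1 - z * x $ 2)) < 1"
  proof (rule ccontr)
    assume "\<not> ?thesis"
    then have le: "1 \<le> cmod ((x $ 1 - z * x $ 3) / (1 - z * x $ 2))" by simp
    then have ne': "x $ 1 - z * x $ 3 \<noteq> 0" by auto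
    define w where "w = (1 - z * x $ 2) / (x $ 1 - z * x $ 3)"
    have "cmod w \<le> 1" using le ne ne' by (simp add: w_def norm_divide field_simps)
    moreover have "w * (x $ 1 - z * x $ 3) = 1 - z * x $ 2" using ne' by (simp add: w_def)
    then have "1 - x $ 1 * w - x $ 2 * z + x $ 3 * w * z = 0" by (simp add: algebra_simps)
    ultimately show False using nz by blast
  qed
qed

lemma DERIV_disc_coordinate:
  fixes \<delta> :: "complex \<Rightarrow> complex ^ 'n"
  assumes "cderiv UNIV (ball 0 1) \<delta> w D" "w \<in> ball 0 1"
  shows "((\<lambda>c. \<delta> c $ i) has_field_derivative D 1 $ i) (at w)"
proof (rule cderiv_imp_DERIV[OF cderiv_compose_disc[OF assms(1) cderiv_linear assms(2) subset_UNIV subspace_UNIV subset_UNIV UNIV_I]])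
  show "bounded_linear (\<lambda>x :: complex ^ 'n. x $ i)" by (rule bounded_linear_vec_nth)
qed (use assms in \<open>auto simp: vec_nth_scaleC\<close>)

lemma cderiv_disc_line_unique:
  fixes e :: "complex ^ 'n"
  assumes D: "cderiv UNIV (ball 0 1) \<delta> 0 D" and line: "\<And>c. cmod c < 1 \<Longrightarrow> \<delta> c = c *\<^sub>C e"
  shows "D 1 = e"
  unfolding vec_eq_iff
proof
  fix i
  have "((\<lambda>c. c * e $ i) has_field_derivative D 1 $ i) (at 0)"
    by (rule has_field_derivative_transform_within_open[OF DERIV_disc_coordinate[OF D] open_ball[of 0 1]])
      (auto simp: line vec_nth_scaleC)
  moreover have "((\<lambda>c. c * e $ i) has_field_derivative e $ i) (at 0)"
    by (auto intro!: derivative_eq_intros)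
  ultimately show "D 1 $ i = e $ i" by (rule DERIV_unique)
qed

text \<open>Choosing the argument of \<open>z\<close> suitably, this says that \<open>(a, b, c)\<close> can be the velocity at \<open>0\<close>
  of a disc in the tetrablock only if \<open>\<bar>a\<bar> + \<bar>c\<bar> \<le> 1\<close>.\<close>

lemma Schwarz_tetrablock:
  fixes \<delta> :: "complex \<Rightarrow> complex ^ 3"
  assumes \<delta>: "analytic_map UNIV (ball 0 1) \<delta>" and E: "\<delta> ` ball 0 1 \<subseteq> tetrablock"
    and 0: "\<delta> 0 = 0" and D: "cderiv UNIV (ball 0 1) \<delta> 0 D" and z: "cmod z \<le> 1"
  shows "cmod (D 1 $ 1 - z * D 1 $ 3) \<le> 1"
proof -
  define g where "g c = (\<delta> c $ 1 - z * \<delta> c $ 3) / (1 - z * \<delta> c $ 2)" for c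
  have ne: "1 - z * \<delta> c $ 2 \<noteq> 0" if "cmod c < 1" for c
    using tetrablock_disc_function(1)[OF _ z] E that by (auto simp: image_subset_iff)
  have g': "(g has_field_derivative ((G 1 $ 1 - z * G 1 $ 3) * (1 - z * \<delta> w $ 2)
      - (\<delta> w $ 1 - z * \<delta> w $ 3) * (- (z * G 1 $ 2))) / ((1 - z * \<delta> w $ 2) * (1 - z * \<delta> w $ 2))) (at w)"
    if "cderiv UNIV (ball 0 1) \<delta> w G" "w \<in> ball 0 1" for w G
    unfolding g_def
    by (rule derivative_eq_intros DERIV_disc_coordinate[OF that] refl | use ne that in \<open>force simp: mult.commute\<close>)+
  have "g holomorphic_on ball 0 1"
    unfolding holomorphic_on_open[OF open_ball] using \<delta> g' by (metis analytic_map_iff_cderiv)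
  moreover have "norm (g c) < 1" if "norm c < 1" for c
    unfolding g_def using tetrablock_disc_function(2)[OF _ z] E that by (auto simp: image_subset_iff)
  moreover have "g 0 = 0" by (simp add: g_def 0)
  moreover have "deriv g 0 = D 1 $ 1 - z * D 1 $ 3"
    using DERIV_imp_deriv[OF g'[OF D]] by (simp add: 0)
  ultimately show ?thesis using Schwarz_Lemma(2)[of g 0] by simp
qed

section \<open>Elements with infinite spectrum\<close>

text \<open>A bounded inverse of \<open>C - c\<close> would send a sequence tending to \<open>0\<close> to the unit vectors \<open>u n\<close>.\<close>

lemma approximate_eigenvalue_in_spectrum:
  assumes u: "\<And>n. norm (u n) = 1" and lim: "(\<lambda>n. blinfun_apply C (u n) - c *\<^sub>C u n) \<longlonglongrightarrow> 0"
  shows "c \<in> op_spectrum C"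
  unfolding op_spectrum_def mem_Collect_eq
proof
  assume "\<exists>S\<in>bounded_clinear_ops. S o\<^sub>L (C - c *\<^sub>C id_blinfun) = id_blinfun \<and> (C - c *\<^sub>C id_blinfun) o\<^sub>L S = id_blinfun"
  then obtain S where S: "S o\<^sub>L (C - c *\<^sub>C id_blinfun) = id_blinfun" by blast
  have "blinfun_apply S (blinfun_apply C (u n) - c *\<^sub>C u n) = u n" for n
    using arg_cong[OF S, of "\<lambda>T. blinfun_apply T (u n)"] by (simp add: blinfun.diff_left scaleC_blinfun.rep_eq)
  moreover have "(\<lambda>n. blinfun_apply S (blinfun_apply C (u n) - c *\<^sub>C u n)) \<longlonglongrightarrow> blinfun_apply S 0"
    by (rule bounded_linear.tendsto[OF blinfun.bounded_linear_right lim])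
  ultimately have "(\<lambda>n. norm (u n)) \<longlonglongrightarrow> 0" by (simp add: tendsto_norm_zero)
  then show False by (simp add: u LIMSEQ_const_iff)
qed

lemma norm_attaining_sequence:
  fixes T :: "'a::real_normed_vector \<Rightarrow>\<^sub>L 'b::real_normed_vector"
  assumes T: "norm T \<ge> r" and r: "r > 0"
  obtains u where "\<And>n. norm (u n) = 1" "\<And>n. norm (blinfun_apply T (u n)) > r - 1 / Suc n"
proof -
  have "\<exists>u. norm u = 1 \<and> norm (blinfun_apply T u) > r - e" if e: "e > 0" for e
  proof (rule ccontr)
    assume "\<not> ?thesis"
    then have le: "norm (blinfun_apply T u) \<le> r - e" if "norm u = 1" for u
      using that by force
    have "norm T \<le> max (r - e) 0"
    proof (rule norm_blinfun_bound)
      fix x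
      show "norm (blinfun_apply T x) \<le> max (r - e) 0 * norm x"
      proof (cases "x = 0")
        case False
        have "norm (blinfun_apply T x) = norm (blinfun_apply T ((1 / norm x) *\<^sub>R x)) * norm x"
          using False by (simp add: blinfun.scaleR_right)
        also have "\<dots> \<le> max (r - e) 0 * norm x"
          using le[of "(1 / norm x) *\<^sub>R x"] False by (intro mult_right_mono) auto
        finally show ?thesis .
      qed simp
    qed simp
    then show False using T r e by linarith
  qed
  then have "\<forall>n. \<exists>u. norm u = 1 \<and> norm (blinfun_apply T u) > r - 1 / Suc n" by simp
  then show ?thesis using that by metis
qed

lemma tendsto_0_if_power2:
  fixes X :: "nat \<Rightarrow> 'a::real_normed_vector"
  assumes "(\<lambda>n. (norm (X n))\<^sup>2) \<longlonglongrightarrow> 0"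
  shows "X \<longlonglongrightarrow> 0"
  using tendsto_real_sqrt[OF assms] by (simp add: tendsto_norm_zero_iff)

text \<open>For a contraction \<open>T\<close> and a unit vector \<open>u\<close>, expanding the square gives
  \<open>(norm (T\<^sup>* T u - u))\<^sup>2 \<le> 2 - 2 (norm (T u))\<^sup>2\<close>.\<close>

lemma tendsto_adjoint_apply:
  fixes T :: "'h::complex_hilbert \<Rightarrow>\<^sub>L 'k::complex_hilbert"
  assumes T: "T \<in> bounded_clinear_ops" "norm T \<le> 1" and u: "\<And>n. norm (u n) = 1"
    and lim: "(\<lambda>n. norm (blinfun_apply T (u n))) \<longlonglongrightarrow> 1"
  shows "(\<lambda>n. blinfun_apply (cadjoint T) (blinfun_apply T (u n)) - u n) \<longlonglongrightarrow> 0"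
proof (rule tendsto_0_if_power2,
    rule tendsto_sandwich[of "\<lambda>_. 0" _ _ "\<lambda>n. 2 - 2 * (norm (blinfun_apply T (u n)))\<^sup>2"])
  have Tu: "norm (blinfun_apply T (u n)) \<le> 1" for n
    using norm_blinfun[of T "u n"] T(2) by (simp add: u)
  show "(\<lambda>n. 2 - 2 * (norm (blinfun_apply T (u n)))\<^sup>2) \<longlonglongrightarrow> 0"
    using tendsto_diff[OF tendsto_const[of 2] tendsto_mult[OF tendsto_const[of 2] tendsto_power[OF lim, of 2]]] by simp
  have "(norm (blinfun_apply (cadjoint T) (blinfun_apply T (u n)) - u n))\<^sup>2 \<le> 2 - 2 * (norm (blinfun_apply T (u n)))\<^sup>2" for n
  proof -
    have "norm (blinfun_apply (cadjoint T) (blinfun_apply T (u n))) \<le> 1 * 1"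
      by (rule order_trans[OF norm_blinfun mult_mono])
        (use order_trans[OF norm_cadjoint_le[OF T(1)] T(2)] Tu in auto)
    then have "(norm (blinfun_apply (cadjoint T) (blinfun_apply T (u n))))\<^sup>2 \<le> 1" by (simp add: power_le_one)
    then show ?thesis by (simp add: norm_diff_square cinner_cadjoint_left[OF T(1)] cinner_self u)
  qed
  then show "\<forall>\<^sub>F n in sequentially. (norm (blinfun_apply (cadjoint T) (blinfun_apply T (u n)) - u n))\<^sup>2 \<le> 2 - 2 * (norm (blinfun_apply T (u n)))\<^sup>2"
    by simp
qed auto

text \<open>Vectors \<open>u\<close> at which \<open>T + \<omega> S\<close> almost attains its norm have \<open>T u \<approx> \<omega> S u\<close> by the
  parallelogram law, since both have norm at most \<open>1\<close>. Therefore \<open>S\<^sup>* T u \<approx> \<omega> u\<close>,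
  \<open>T\<^sup>* S u \<approx> cnj \<omega> u\<close>, \<open>R u \<approx> (1 + \<omega>) T u\<close> and \<open>R\<^sup>* T u \<approx> (1 + cnj \<omega>) u\<close>.\<close>

lemma spectrum_of_ell1_pair:
  fixes T S :: "'h::complex_hilbert \<Rightarrow>\<^sub>L 'k::complex_hilbert"
  assumes T: "T \<in> bounded_clinear_ops" "norm T \<le> 1" and S: "S \<in> bounded_clinear_ops" "norm S \<le> 1"
    and \<omega>: "cmod \<omega> = 1" and TS: "norm (T + \<omega> *\<^sub>C S) \<ge> 2"
  defines "R \<equiv> T + (T o\<^sub>L cadjoint S o\<^sub>L T)"
  shows "(1 + \<omega>) * (1 + cnj \<omega>) \<in> op_spectrum (cadjoint R o\<^sub>L R)"
proof -
  let ?ap = blinfun_apply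
  obtain u where u: "\<And>n. norm (u n) = 1" and big: "\<And>n. norm (?ap (T + \<omega> *\<^sub>C S) (u n)) > 2 - 1 / Suc n"
    by (rule norm_attaining_sequence[OF TS]) (simp, rule that)
  have Tu: "norm (?ap T (u n)) \<le> 1" and Su: "norm (?ap S (u n)) \<le> 1" for n
    using norm_blinfun[of T "u n"] norm_blinfun[of S "u n"] T(2) S(2) by (simp_all add: u)
  have ap: "?ap (T + \<omega> *\<^sub>C S) x = ?ap T x + \<omega> *\<^sub>C ?ap S x" for x
    by (simp add: blinfun.add_left scaleC_blinfun.rep_eq)
  have lower: "1 - 1 / Suc n \<le> norm (?ap T (u n))" "1 - 1 / Suc n \<le> norm (?ap S (u n))" for n
    using big[of n] norm_triangle_ineq[of "?ap T (u n)" "\<omega> *\<^sub>C ?ap S (u n)"] Tu[of n] Su[of n]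
    unfolding ap by (simp_all add: norm_scaleC \<omega>)
  have inv0: "(\<lambda>n. 1 / real (Suc n)) \<longlonglongrightarrow> 0"
    using LIMSEQ_inverse_real_of_nat by (simp add: inverse_eq_divide)
  have "(\<lambda>n. 1 - 1 / real (Suc n)) \<longlonglongrightarrow> 1 - 0" by (intro tendsto_diff tendsto_const inv0)
  then have low1: "(\<lambda>n. 1 - 1 / real (Suc n)) \<longlonglongrightarrow> 1" by simp
  have limT: "(\<lambda>n. norm (?ap T (u n))) \<longlonglongrightarrow> 1" and limS: "(\<lambda>n. norm (?ap S (u n))) \<longlonglongrightarrow> 1"
    by (rule tendsto_sandwich[OF _ _ low1 tendsto_const]; use lower Tu Su in simp)+
  have d: "(\<lambda>n. ?ap T (u n) - \<omega> *\<^sub>C ?ap S (u n)) \<longlonglongrightarrow> 0"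
  proof (rule tendsto_0_if_power2,
      rule tendsto_sandwich[of "\<lambda>_. 0" _ _ "\<lambda>n. 4 - (2 - 1 / real (Suc n))\<^sup>2"])
    have "(\<lambda>n. 4 - (2 - 1 / real (Suc n))\<^sup>2) \<longlonglongrightarrow> 4 - (2 - 0)\<^sup>2" by (intro tendsto_intros inv0)
    then show "(\<lambda>n. 4 - (2 - 1 / real (Suc n))\<^sup>2) \<longlonglongrightarrow> 0" by simp
    have "(norm (?ap T (u n) - \<omega> *\<^sub>C ?ap S (u n)))\<^sup>2 \<le> 4 - (2 - 1 / real (Suc n))\<^sup>2" for n
    proof -
      have "(2 - 1 / real (Suc n))\<^sup>2 \<le> (norm (?ap T (u n) + \<omega> *\<^sub>C ?ap S (u n)))\<^sup>2"
        using big[of n] unfolding ap by (intro power_mono) (auto simp: field_simps)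
      moreover have "(norm (?ap T (u n)))\<^sup>2 \<le> 1" "(norm (\<omega> *\<^sub>C ?ap S (u n)))\<^sup>2 \<le> 1"
        using Tu[of n] Su[of n] by (simp_all add: norm_scaleC \<omega> power_le_one)
      ultimately show ?thesis unfolding parallelogram by linarith
    qed
    then show "\<forall>\<^sub>F n in sequentially. (norm (?ap T (u n) - \<omega> *\<^sub>C ?ap S (u n)))\<^sup>2 \<le> 4 - (2 - 1 / real (Suc n))\<^sup>2"
      by simp
  qed auto
  have TT: "(\<lambda>n. ?ap (cadjoint T) (?ap T (u n)) - u n) \<longlonglongrightarrow> 0"
    and SS: "(\<lambda>n. ?ap (cadjoint S) (?ap S (u n)) - u n) \<longlonglongrightarrow> 0"
    by (rule tendsto_adjoint_apply; use T S u limT limS in simp)+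
  note cl = T(1) S(1) cadjoint_clinear[OF T(1)] cadjoint_clinear[OF S(1)]
  note lin = blinfun.add_left blinfun.add_right blinfun.diff_left blinfun.diff_right clinear_scaleC[OF cl(1)]
    clinear_scaleC[OF cl(2)] clinear_scaleC[OF cl(3)] clinear_scaleC[OF cl(4)] scaleC_scaleC
    scaleC_add_left scaleC_add_right scaleC.diff_right
  note lim0 = tendsto_add_zero bounded_linear.tendsto_zero[OF blinfun.bounded_linear_right]
    bounded_linear.tendsto_zero[OF scaleC.bounded_linear_right]
  have \<omega>\<omega>: "cnj \<omega> * \<omega> = 1" using \<omega> complex_norm_square[of \<omega>] by (simp add: mult.commute)
  have ST: "(\<lambda>n. ?ap (cadjoint S) (?ap T (u n)) - \<omega> *\<^sub>C u n) \<longlonglongrightarrow> 0"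
  proof -
    have "(\<lambda>n. ?ap (cadjoint S) (?ap T (u n) - \<omega> *\<^sub>C ?ap S (u n)) + \<omega> *\<^sub>C (?ap (cadjoint S) (?ap S (u n)) - u n)) \<longlonglongrightarrow> 0"
      by (intro lim0 d SS)
    then show ?thesis by (simp add: lin)
  qed
  have TS': "(\<lambda>n. ?ap (cadjoint T) (?ap S (u n)) - cnj \<omega> *\<^sub>C u n) \<longlonglongrightarrow> 0"
  proof -
    have "(\<lambda>n. (- cnj \<omega>) *\<^sub>C ?ap (cadjoint T) (?ap T (u n) - \<omega> *\<^sub>C ?ap S (u n)) + cnj \<omega> *\<^sub>C (?ap (cadjoint T) (?ap T (u n)) - u n)) \<longlonglongrightarrow> 0"
      by (intro lim0 d TT)
    then show ?thesis by (simp add: lin scaleC.minus_left \<omega>\<omega>)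
  qed
  have RT: "(\<lambda>n. ?ap R (u n) - (1 + \<omega>) *\<^sub>C ?ap T (u n)) \<longlonglongrightarrow> 0"
  proof -
    have "(\<lambda>n. ?ap T (?ap (cadjoint S) (?ap T (u n)) - \<omega> *\<^sub>C u n)) \<longlonglongrightarrow> 0"
      by (intro lim0 ST)
    then show ?thesis by (simp add: lin R_def algebra_simps)
  qed
  have "cadjoint R = cadjoint T + (cadjoint T o\<^sub>L (S o\<^sub>L cadjoint T))"
    by (simp add: R_def cadjoint_add cadjoint_compose cadjoint_cadjoint clinear_compose cl)
  then have R': "?ap (cadjoint R) y = ?ap (cadjoint T) y + ?ap (cadjoint T) (?ap S (?ap (cadjoint T) y))" for y
    by (simp add: blinfun.add_left)
  have RTu: "(\<lambda>n. ?ap (cadjoint R) (?ap T (u n)) - (1 + cnj \<omega>) *\<^sub>C u n) \<longlonglongrightarrow> 0"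
  proof -
    have "(\<lambda>n. (?ap (cadjoint T) (?ap T (u n)) - u n)
        + (?ap (cadjoint T) (?ap S (?ap (cadjoint T) (?ap T (u n)) - u n))
        + (?ap (cadjoint T) (?ap S (u n)) - cnj \<omega> *\<^sub>C u n))) \<longlonglongrightarrow> 0"
      by (intro lim0 TT TS')
    then show ?thesis by (simp add: lin R' algebra_simps)
  qed
  have "(\<lambda>n. ?ap (cadjoint R) (?ap R (u n) - (1 + \<omega>) *\<^sub>C ?ap T (u n))
      + (1 + \<omega>) *\<^sub>C (?ap (cadjoint R) (?ap T (u n)) - (1 + cnj \<omega>) *\<^sub>C u n)) \<longlonglongrightarrow> 0"
    by (intro lim0 RT RTu)
  moreover have "?ap (cadjoint R) (x - c *\<^sub>C y) = ?ap (cadjoint R) x - c *\<^sub>C ?ap (cadjoint R) y" for x y c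
    by (simp add: R' lin algebra_simps)
  ultimately have "(\<lambda>n. ?ap (cadjoint R o\<^sub>L R) (u n) - ((1 + \<omega>) * (1 + cnj \<omega>)) *\<^sub>C u n) \<longlonglongrightarrow> 0"
    by (simp add: scaleC.diff_right scaleC_scaleC)
  then show ?thesis by (rule approximate_eigenvalue_in_spectrum[OF u])
qed

lemma (in J_star) infinite_rank_if_ell1_pair:
  assumes T: "T \<in> A" "norm T \<le> 1" and S: "S \<in> A" "norm S \<le> 1"
    and TS: "\<And>\<omega>. cmod \<omega> = 1 \<Longrightarrow> norm (T + \<omega> *\<^sub>C S) \<ge> 2"
  shows "J_star_rank A = \<infinity>"
proof -
  define R where "R = T + (T o\<^sub>L cadjoint S o\<^sub>L T)"
  have RA: "R \<in> A" unfolding R_def by (intro add triple T S)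
  have "complex_of_real ` {0<..<4} \<subseteq> op_spectrum (cadjoint R o\<^sub>L R) - {0}"
  proof (clarsimp)
    fix r :: real assume r: "0 < r" "r < 4"
    \<comment> \<open>\<open>\<omega>\<close> is chosen with real part \<open>r / 2 - 1\<close>, since \<open>\<bar>1 + \<omega>\<bar>\<^sup>2 = 2 + 2 Re \<omega>\<close>.\<close>
    define a where "a = r / 2 - 1"
    have a2: "a\<^sup>2 \<le> 1" using r by (simp add: a_def abs_square_le_1 abs_le_iff)
    define \<omega> where "\<omega> = Complex a (sqrt (1 - a\<^sup>2))"
    have \<omega>: "cmod \<omega> = 1" using a2 by (simp add: \<omega>_def cmod_def)
    have "(1 + \<omega>) * (1 + cnj \<omega>) = 1 + (\<omega> + cnj \<omega>) + \<omega> * cnj \<omega>" by (simp add: algebra_simps)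
    also have "\<omega> * cnj \<omega> = 1" using complex_norm_square[of \<omega>] \<omega> by simp
    also have "\<omega> + cnj \<omega> = of_real (2 * a)" by (simp add: complex_add_cnj \<omega>_def)
    finally have "(1 + \<omega>) * (1 + cnj \<omega>) = of_real r" by (simp add: a_def)
    then show "complex_of_real r \<in> op_spectrum (cadjoint R o\<^sub>L R)"
      using spectrum_of_ell1_pair[OF clinear[OF T(1)] T(2) clinear[OF S(1)] S(2) \<omega> TS[OF \<omega>]]
      by (simp add: R_def)
  qed
  moreover have "infinite (complex_of_real ` {0<..<4})"
    by (subst finite_image_iff) (auto simp: inj_on_def)
  ultimately have "infinite (op_spectrum (cadjoint R o\<^sub>L R) - {0})" using finite_subset by blast
  then have "ecard (op_spectrum (cadjoint R o\<^sub>L R) - {0}) = \<infinity>" by (simp add: ecard_def)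
  then have "\<infinity> \<le> J_star_rank A" unfolding J_star_rank_def using SUP_upper[OF RA, of "\<lambda>T. ecard (op_spectrum (cadjoint T o\<^sub>L T) - {0})"] by simp
  then show ?thesis by simp
qed

section \<open>The tetrablock is not a retract\<close>

lemma zero_in_tetrablock: "0 \<in> tetrablock"
  by (simp add: tetrablock_def)

text \<open>Composing with the Moebius transformations for \<open>B = h 0\<close> and \<open>-B\<close> moves the base point to
  the centre of the ball.\<close>

lemma (in J_star) normalized_retraction:
  assumes "analytic_retract UNIV tetrablock A (open_unit_ball A)"
  obtains h \<kappa> where "analytic_map UNIV tetrablock h" "h ` tetrablock \<subseteq> open_unit_ball A"
    "analytic_map A (open_unit_ball A) \<kappa>" "\<kappa> ` open_unit_ball A \<subseteq> tetrablock"
    "\<And>x. x \<in> tetrablock \<Longrightarrow> \<kappa> (h x) = x" "h 0 = 0"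
proof -
  obtain h \<kappa> where h: "analytic_map UNIV tetrablock h" "h ` tetrablock \<subseteq> open_unit_ball A"
    and \<kappa>: "analytic_map A (open_unit_ball A) \<kappa>" "\<kappa> ` open_unit_ball A \<subseteq> tetrablock"
    and \<kappa>h: "\<And>x. x \<in> tetrablock \<Longrightarrow> \<kappa> (h x) = x"
    using assms by (auto simp: analytic_retract_def)
  define B where "B = h 0"
  have B: "B \<in> A" "norm B < 1" using h(2) zero_in_tetrablock by (auto simp: B_def open_unit_ball_def)
  have mB: "- B \<in> A" "norm (- B) < 1" using B minus by auto
  have ball: "op_moebius C ` open_unit_ball A \<subseteq> open_unit_ball A" if "C \<in> A" "norm C < 1" for C
    using moebius_mem[OF that] norm_moebius_less_1[OF clinear[OF that(1)] that(2)] by (auto simp: open_unit_ball_def)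
  have sub: "open_unit_ball A \<subseteq> A" by (auto simp: open_unit_ball_def)
  have inv: "op_moebius B (op_moebius (- B) Z) = Z" if "norm Z < 1" for Z
    using moebius_inverse[OF clinear[OF mB(1)] mB(2) that] by simp
  show ?thesis
  proof (rule that[of "\<lambda>x. op_moebius (- B) (h x)" "\<lambda>Z. \<kappa> (op_moebius B Z)"])
    show "analytic_map UNIV tetrablock (\<lambda>x. op_moebius (- B) (h x))"
      by (rule analytic_map_compose[OF h(1) moebius_analytic[OF mB] _ _ sub subspace closed h(2) tetrablock_eventually])
        (simp_all add: subspace_UNIV)
    show "analytic_map A (open_unit_ball A) (\<lambda>Z. \<kappa> (op_moebius B Z))"
      by (rule analytic_map_compose[OF moebius_analytic[OF B] \<kappa>(1) sub subspace sub subspace closed ball[OF B]])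
        (rule eventually_open_unit_ball[OF subspace])
    show "(\<lambda>x. op_moebius (- B) (h x)) ` tetrablock \<subseteq> open_unit_ball A"
      "(\<lambda>Z. \<kappa> (op_moebius B Z)) ` open_unit_ball A \<subseteq> tetrablock"
      using h(2) \<kappa>(2) ball[OF B] ball[OF mB] by blast+
    show "\<kappa> (op_moebius B (op_moebius (- B) (h x))) = x" if "x \<in> tetrablock" for x
      using inv[of "h x"] \<kappa>h[OF that] h(2) that by (auto simp: open_unit_ball_def)
    show "op_moebius (- B) (h 0) = 0"
      using moebius_inverse[OF clinear[OF B(1)] B(2), of 0] moebius_zero[OF clinear[OF B(1)] B(2)] by (simp add: B_def)
  qed
qed

theorem theorem3p1:
  fixes A :: "('h::complex_hilbert \<Rightarrow>\<^sub>L 'k::complex_hilbert) set"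
  assumes "J_star_algebra A"
    and "J_star_rank A < \<infinity>"
  shows "\<not> analytic_retract UNIV tetrablock A (open_unit_ball A)"
proof
  assume retract: "analytic_retract UNIV tetrablock A (open_unit_ball A)"
  interpret J_star A by unfold_locales fact
  obtain h \<kappa> where h: "analytic_map UNIV tetrablock h" "h ` tetrablock \<subseteq> open_unit_ball A"
    and \<kappa>: "analytic_map A (open_unit_ball A) \<kappa>" "\<kappa> ` open_unit_ball A \<subseteq> tetrablock"
    and \<kappa>h: "\<And>x. x \<in> tetrablock \<Longrightarrow> \<kappa> (h x) = x" and h0: "h 0 = 0"
    using normalized_retraction[OF retract] by blast
  have sub: "open_unit_ball A \<subseteq> A" by (auto simp: open_unit_ball_def)
  have zero_mem: "0 \<in> open_unit_ball A" using zero by (simp add: open_unit_ball_def)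
  have \<kappa>0: "\<kappa> 0 = 0" using \<kappa>h[OF zero_in_tetrablock] h0 by simp
  obtain H where H: "cderiv UNIV tetrablock h 0 H"
    using h(1) zero_in_tetrablock by (auto simp: analytic_map_iff_cderiv)
  obtain K where K: "cderiv A (open_unit_ball A) \<kappa> 0 K"
    using \<kappa>(1) zero_mem by (auto simp: analytic_map_iff_cderiv)
  have HA: "H v \<in> A" for v
    by (rule cderiv_mem[OF H closed subspace _ zero_in_tetrablock _ tetrablock_eventually[OF zero_in_tetrablock]])
      (use h(2) sub in auto)
  have disc: "norm (H e) \<le> 1" "K (H e) = e" if e: "\<And>c. cmod c < 1 \<Longrightarrow> c *\<^sub>C e \<in> tetrablock" for e
  proof -
    have img: "(\<lambda>c. c *\<^sub>C e) ` ball 0 1 \<subseteq> tetrablock" using e by auto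
    have an: "analytic_map UNIV (ball 0 1) (\<lambda>c. h (c *\<^sub>C e))"
      unfolding analytic_map_iff_cderiv
    proof
      fix w :: complex assume w: "w \<in> ball 0 1"
      then obtain G where "cderiv UNIV tetrablock h (w *\<^sub>C e) G"
        using h(1) e by (auto simp: analytic_map_iff_cderiv)
      from cderiv_compose_disc[OF cderiv_line this w _ subspace_UNIV img]
      show "\<exists>D. cderiv UNIV (ball 0 1) (\<lambda>c. h (c *\<^sub>C e)) w D" by blast
    qed
    have D: "cderiv UNIV (ball 0 1) (\<lambda>c. h (c *\<^sub>C e)) 0 (\<lambda>c. H (c *\<^sub>C e))"
      by (rule cderiv_compose_disc[OF cderiv_line _ _ _ subspace_UNIV img]) (use H in auto)
    show "norm (H e) \<le> 1"
      using Schwarz_operator_disc[OF an _ _ D] h(2) e h0 by (auto simp: open_unit_ball_def)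
    have "cderiv UNIV (ball 0 1) (\<lambda>c. \<kappa> (h (c *\<^sub>C e))) 0 (\<lambda>c. K (H (c *\<^sub>C e)))"
      by (rule cderiv_compose_disc[OF D _ _ sub subspace]) (use K h0 h(2) e HA in auto)
    from cderiv_disc_line_unique[OF this, of e] show "K (H e) = e"
      using \<kappa>h e by simp
  qed
  define T S where "T = H (axis 1 1)" and "S = H (axis 3 1)"
  have T: "T \<in> A" "norm T \<le> 1" "K T = axis 1 1" and S: "S \<in> A" "norm S \<le> 1" "K S = axis 3 1"
    using HA disc axis_in_tetrablock by (auto simp: T_def S_def)
  have "norm (T + \<omega> *\<^sub>C S) \<ge> 2" if \<omega>: "cmod \<omega> = 1" for \<omega>
  proof (rule ccontr)
    assume less: "\<not> ?thesis"
    \<comment> \<open>Any positive \<open>r < 2\<close> that bounds the norm will do; the midpoint is positive even when the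
      norm is \<open>0\<close>. The disc in direction \<open>U\<close> then has a velocity of length \<open>2 / r > 1\<close>.\<close>
    define r where "r = (norm (T + \<omega> *\<^sub>C S) + 2) / 2"
    have r: "0 < r" "r < 2" "norm (T + \<omega> *\<^sub>C S) \<le> r" using less by (auto simp: r_def add_nonneg_pos)
    define U where "U = (1 / complex_of_real r) *\<^sub>C (T + \<omega> *\<^sub>C S)"
    have U: "U \<in> A" unfolding U_def by (intro scale add T S)
    have nU: "norm U \<le> 1" using r by (simp add: U_def norm_scaleC norm_divide)
    have cU: "c *\<^sub>C U \<in> open_unit_ball A" if "cmod c < 1" for c
      using that nU U mult_left_le[of "norm U" "cmod c"] by (simp add: open_unit_ball_def scale norm_scaleC)
    then have img: "(\<lambda>c. c *\<^sub>C U) ` ball 0 1 \<subseteq> open_unit_ball A" by auto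
    have an: "analytic_map UNIV (ball 0 1) (\<lambda>c. \<kappa> (c *\<^sub>C U))"
      unfolding analytic_map_iff_cderiv
    proof
      fix w :: complex assume w: "w \<in> ball 0 1"
      then obtain G where "cderiv A (open_unit_ball A) \<kappa> (w *\<^sub>C U) G"
        using \<kappa>(1) cU by (auto simp: analytic_map_iff_cderiv)
      from cderiv_compose_disc[OF cderiv_line this w sub subspace img]
      show "\<exists>D. cderiv UNIV (ball 0 1) (\<lambda>c. \<kappa> (c *\<^sub>C U)) w D" using U by auto
    qed
    have D: "cderiv UNIV (ball 0 1) (\<lambda>c. \<kappa> (c *\<^sub>C U)) 0 (\<lambda>c. K (c *\<^sub>C U))"
      by (rule cderiv_compose_disc[OF cderiv_line _ _ sub subspace img]) (use K U in auto)
    have "K U = (1 / complex_of_real r) *\<^sub>C (axis 1 1 + \<omega> *\<^sub>C axis 3 1)"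
      unfolding U_def using T S by (simp add: cderiv_scaleC[OF K] cderiv_add[OF K] add scale)
    then have "K (1 *\<^sub>C U) $ 1 - (- cnj \<omega>) * K (1 *\<^sub>C U) $ 3 = (1 + cnj \<omega> * \<omega>) / complex_of_real r"
      by (simp add: vec_nth_scaleC axis_def add_divide_distrib)
    also have "cnj \<omega> * \<omega> = 1" using complex_norm_square[of \<omega>] \<omega> by (simp add: mult.commute)
    finally have *: "K (1 *\<^sub>C U) $ 1 - (- cnj \<omega>) * K (1 *\<^sub>C U) $ 3 = 2 / complex_of_real r" by simp
    have "(\<lambda>c. \<kappa> (c *\<^sub>C U)) ` ball 0 1 \<subseteq> tetrablock" using img \<kappa>(2) by blast
    from Schwarz_tetrablock[OF an this _ D, of "- cnj \<omega>"]
    have "cmod (2 / complex_of_real r) \<le> 1" unfolding * using \<kappa>0 \<omega> by simp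
    then show False using r by (simp add: norm_divide field_simps)
  qed
  then have "J_star_rank A = \<infinity>" using infinite_rank_if_ell1_pair T S by blast
  with assms(2) show False by simp
qed

end
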